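(* Let $G=(V,E)$ be a connected and locally finite weighted graph with a measure $\sigma$ satisfying $\sigma(x)\ge\sigma_0>0$ for all $x\in V$ and some constant $\sigma_0$. Let $p>1$ and let $\rho:V\to[0,+\infty)$ satisfy $\rho(x)\to+\infty$ as $d(x)\to+\infty$. Suppose that $\psi:V\times[0,+\infty)\to\mathbb{R}$, with primitive $\Psi(x,s)=\int_0^s\psi(x,t)\,dt$, satisfies: (i) $\psi(x,0)=0$ for every $x\in V$, $\psi(x,s)$ is continuous in $s\in[0,+\infty)$, and for every $M>0$ there is a constant $A_M$ such that $\psi(x,s)\le A_M$ for all $(x,s)\in V\times[0,M]$; (ii) there is a constant $\alpha>p$ such that $0<\alpha\Psi(x,s)\le s\psi(x,s)$ for all $s>0$ and $x\in V$; (iii) $\limsup_{s\to0+}\psi(x,s)/s^{p-1}<\lambda_p$ uniformly in $x\in V$; (iv) for every $x\in V$, $\psi(x,s)/s^{p-1}$ is strictly increasing in $s>0$. Then the equation $$-\Delta_p u+\rho|u|^{p-2}u=\psi(x,u^+)\quad\text{in }V$$ has a strictly positive ground state solution in $\mathcal{H}_p(V)$: there is $u\in\mathcal{N}_\psi$ with $J(u)=\inf_{v\in\mathcal{N}_\psi}J(v)$ that solves the equation at every $x\in V$ and satisfies $u(x)>0$ for all $x\in V$.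
   Context: $G=(V,E)$ is a graph with vertex set $V$ and edge set $E$; $y\sim x$ means $xy\in E$; locally finite means every vertex has finitely many neighbours. Each edge has a weight $w_{xy}=w_{yx}>0$. $d(x)=dist(x,O)$ is the graph distance from $x$ to a fixed vertex $O\in V$. For $u:V\to\mathbb{R}$, $u^+=\max\{u,0\}$ and $\int_V u\,d\sigma=\sum_{x\in V}\sigma(x)u(x)$; $\|u\|_p=(\int_V|u|^pd\sigma)^{1/p}$. Gradient: if $y_1,\dots,y_{\ell_x}$ are the neighbours of $x$, $\nabla u(x)=\big(\sqrt{w_{xy_i}/(2\sigma(x))}\,(u(y_i)-u(x))\big)_{i=1}^{\ell_x}\in\mathbb{R}^{\ell_x}$, $\nabla u\nabla v(x)$ is the Euclidean inner product, and $|\nabla u|(x)=\big(\frac{1}{2\sigma(x)}\sum_{y\sim x}w_{xy}(u(y)-u(x))^2\big)^{1/2}$. $p$-Laplacian: $\Delta_pu(x)=\frac{1}{\sigma(x)}\sum_{y\sim x}\frac{|\nabla u|^{p-2}(x)+|\nabla u|^{p-2}(y)}{2}w_{xy}(u(y)-u(x))$. When $1<p<2$, terms with $u(y)=u(x)$ are read as $0$, and $|\nabla u|^{p-2}\nabla u$, $|u|^{p-2}u$ are read as $0$ where $\nabla u=0$, resp. $u=0$. $\mathcal{H}_p(V)$ is the completion of $C_c(V)$ (finitely supported functions on $V$) under the norm $\|u\|_{\mathcal{H}_p}=\big(\int_V(|\nabla u|^p+\rho|u|^p)d\sigma\big)^{1/p}$, regarded as a space of functions on $V$. $\lambda_p=\inf_{u\in\mathcal{H}_p(V),\,u\not\equiv0}\|u\|_{\mathcal{H}_p}^p/\|u\|_p^p$.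 In (iii), "uniformly" means there are $\tau<\lambda_p$ and $\delta>0$ with $\psi(x,s)\le\tau s^{p-1}$ for all $x\in V$, $0<s<\delta$. The functional $J:\mathcal{H}_p(V)\to\mathbb{R}$ is $J(u)=\frac1p\|u\|_{\mathcal{H}_p}^p-\int_V\Psi(x,u^+)d\sigma$, with $\langle J'(u),\varphi\rangle=\int_V(|\nabla u|^{p-2}\nabla u\nabla\varphi+\rho|u|^{p-2}u\varphi-\psi(x,u^+)\varphi)d\sigma$. The Nehari manifold is $\mathcal{N}_\psi=\{u\in\mathcal{H}_p(V)\setminus\{0\}:\langle J'(u),u\rangle=0\}$. A ground state solution is a solution lying in $\mathcal{N}_\psi$ at which $J$ attains $\inf_{\mathcal{N}_\psi}J$. *)

theory Defs
  imports "HOL-Analysis.Analysis"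
begin

text \<open>
  The vertex set \<open>V\<close> is the whole type \<open>'v\<close>, and \<open>E\<close> is a set of two-element sets.
  A weight \<open>w x y\<close> is only ever evaluated at adjacent \<open>x\<close>, \<open>y\<close>.
\<close>

definition simple_graph :: "'v set set \<Rightarrow> bool" where
  "simple_graph E \<longleftrightarrow> (\<forall>e\<in>E. card e = 2)"

definition nbrs :: "'v set set \<Rightarrow> 'v \<Rightarrow> 'v set" where
  "nbrs E x = {y. {x, y} \<in> E}"

definition adj_rel :: "'v set set \<Rightarrow> ('v \<times> 'v) set" where
  "adj_rel E = {(x, y). y \<in> nbrs E x}"

definition locally_finite_graph :: "'v set set \<Rightarrow> bool" where
  "locally_finite_graph E \<longleftrightarrow> (\<forall>x. finite (nbrs E x))"

definition connected_graph :: "'v set set \<Rightarrow> bool" where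
  "connected_graph E \<longleftrightarrow> (\<forall>x y. (x, y) \<in> (adj_rel E)\<^sup>*)"

definition graph_dist :: "'v set set \<Rightarrow> 'v \<Rightarrow> 'v \<Rightarrow> nat" where
  "graph_dist E x y = (LEAST n. (x, y) \<in> adj_rel E ^^ n)"

definition edge_weight :: "'v set set \<Rightarrow> ('v \<Rightarrow> 'v \<Rightarrow> real) \<Rightarrow> bool" where
  "edge_weight E w \<longleftrightarrow> (\<forall>x y. {x, y} \<in> E \<longrightarrow> w x y = w y x \<and> w x y > 0)"

definition integral_V :: "('v \<Rightarrow> real) \<Rightarrow> ('v \<Rightarrow> real) \<Rightarrow> real" where
  "integral_V \<sigma> u = (\<Sum>\<^sub>\<infinity>x. \<sigma> x * u x)"

definition Lp_norm :: "('v \<Rightarrow> real) \<Rightarrow> real \<Rightarrow> ('v \<Rightarrow> real) \<Rightarrow> real" where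
  "Lp_norm \<sigma> p u = integral_V \<sigma> (\<lambda>x. \<bar>u x\<bar> powr p) powr (1 / p)"

text \<open>The component of \<open>\<nabla>u(x)\<close> belonging to the neighbour \<open>y\<close> of \<open>x\<close>.\<close>

definition grad :: "('v \<Rightarrow> 'v \<Rightarrow> real) \<Rightarrow> ('v \<Rightarrow> real) \<Rightarrow> ('v \<Rightarrow> real) \<Rightarrow> 'v \<Rightarrow> 'v \<Rightarrow> real" where
  "grad w \<sigma> u x y = sqrt (w x y / (2 * \<sigma> x)) * (u y - u x)"

definition grad_inner ::
  "'v set set \<Rightarrow> ('v \<Rightarrow> 'v \<Rightarrow> real) \<Rightarrow> ('v \<Rightarrow> real) \<Rightarrow> ('v \<Rightarrow> real) \<Rightarrow> ('v \<Rightarrow> real) \<Rightarrow> 'v \<Rightarrow> real" where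
  "grad_inner E w \<sigma> u v x = (\<Sum>y\<in>nbrs E x. grad w \<sigma> u x y * grad w \<sigma> v x y)"

definition grad_norm ::
  "'v set set \<Rightarrow> ('v \<Rightarrow> 'v \<Rightarrow> real) \<Rightarrow> ('v \<Rightarrow> real) \<Rightarrow> ('v \<Rightarrow> real) \<Rightarrow> 'v \<Rightarrow> real" where
  "grad_norm E w \<sigma> u x = sqrt (1 / (2 * \<sigma> x) * (\<Sum>y\<in>nbrs E x. w x y * (u y - u x)\<^sup>2))"

text \<open>
  Below, \<open>powr\<close> with exponent \<open>p - 2\<close> satisfies \<open>0 powr (p - 2) = 0\<close> for every \<open>p\<close>.  Each
  such power occurs multiplied by a factor that vanishes when its base does (for adjacent \<open>x\<close>, \<open>y\<close>,
  a zero gradient at either end forces \<open>u y = u x\<close>), so the singular terms are \<open>0\<close> when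
  \<open>p < 2\<close>, and the value for \<open>p = 2\<close> is the usual one.
\<close>

definition p_Laplacian ::
  "'v set set \<Rightarrow> ('v \<Rightarrow> 'v \<Rightarrow> real) \<Rightarrow> ('v \<Rightarrow> real) \<Rightarrow> real \<Rightarrow> ('v \<Rightarrow> real) \<Rightarrow> 'v \<Rightarrow> real" where
  "p_Laplacian E w \<sigma> p u x =
     1 / \<sigma> x * (\<Sum>y\<in>nbrs E x.
       (grad_norm E w \<sigma> u x powr (p - 2) + grad_norm E w \<sigma> u y powr (p - 2)) / 2
         * w x y * (u y - u x))"

definition C_c :: "('v \<Rightarrow> real) set" where
  "C_c = {u. finite {x. u x \<noteq> 0}}"

definition Hp_norm ::
  "'v set set \<Rightarrow> ('v \<Rightarrow> 'v \<Rightarrow> real) \<Rightarrow> ('v \<Rightarrow> real) \<Rightarrow> real \<Rightarrow> ('v \<Rightarrow> real) \<Rightarrow> ('v \<Rightarrow> real) \<Rightarrow> real" where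
  "Hp_norm E w \<sigma> p \<rho> u =
     integral_V \<sigma> (\<lambda>x. grad_norm E w \<sigma> u x powr p + \<rho> x * \<bar>u x\<bar> powr p) powr (1 / p)"

text \<open>
  The completion of \<open>C_c\<close> as a space of functions: the class of a Cauchy sequence in \<open>C_c\<close> is
  identified with its pointwise limit.
\<close>

definition Hp ::
  "'v set set \<Rightarrow> ('v \<Rightarrow> 'v \<Rightarrow> real) \<Rightarrow> ('v \<Rightarrow> real) \<Rightarrow> real \<Rightarrow> ('v \<Rightarrow> real) \<Rightarrow> ('v \<Rightarrow> real) set" where
  "Hp E w \<sigma> p \<rho> =
     {u. \<exists>f :: nat \<Rightarrow> 'v \<Rightarrow> real. (\<forall>n. f n \<in> C_c)
        \<and> (\<forall>e>0. \<exists>N. \<forall>m\<ge>N. \<forall>n\<ge>N. Hp_norm E w \<sigma> p \<rho> (\<lambda>x. f m x - f n x) < e)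
        \<and> (\<forall>x. (\<lambda>n. f n x) \<longlonglongrightarrow> u x)}"

definition lambda_p ::
  "'v set set \<Rightarrow> ('v \<Rightarrow> 'v \<Rightarrow> real) \<Rightarrow> ('v \<Rightarrow> real) \<Rightarrow> real \<Rightarrow> ('v \<Rightarrow> real) \<Rightarrow> real" where
  "lambda_p E w \<sigma> p \<rho> =
     (INF u\<in>Hp E w \<sigma> p \<rho> - {\<lambda>x. 0}. Hp_norm E w \<sigma> p \<rho> u powr p / Lp_norm \<sigma> p u powr p)"

definition primitive :: "('v \<Rightarrow> real \<Rightarrow> real) \<Rightarrow> 'v \<Rightarrow> real \<Rightarrow> real" where
  "primitive \<psi> x s = integral {0..s} (\<psi> x)"

definition pos_part :: "('v \<Rightarrow> real) \<Rightarrow> 'v \<Rightarrow> real" where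
  "pos_part u x = max (u x) 0"

definition J_fun ::
  "'v set set \<Rightarrow> ('v \<Rightarrow> 'v \<Rightarrow> real) \<Rightarrow> ('v \<Rightarrow> real) \<Rightarrow> real \<Rightarrow> ('v \<Rightarrow> real)
     \<Rightarrow> ('v \<Rightarrow> real \<Rightarrow> real) \<Rightarrow> ('v \<Rightarrow> real) \<Rightarrow> real" where
  "J_fun E w \<sigma> p \<rho> \<psi> u =
     1 / p * Hp_norm E w \<sigma> p \<rho> u powr p - integral_V \<sigma> (\<lambda>x. primitive \<psi> x (pos_part u x))"

definition J_deriv ::
  "'v set set \<Rightarrow> ('v \<Rightarrow> 'v \<Rightarrow> real) \<Rightarrow> ('v \<Rightarrow> real) \<Rightarrow> real \<Rightarrow> ('v \<Rightarrow> real)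
     \<Rightarrow> ('v \<Rightarrow> real \<Rightarrow> real) \<Rightarrow> ('v \<Rightarrow> real) \<Rightarrow> ('v \<Rightarrow> real) \<Rightarrow> real" where
  "J_deriv E w \<sigma> p \<rho> \<psi> u \<phi> =
     integral_V \<sigma> (\<lambda>x. grad_norm E w \<sigma> u x powr (p - 2) * grad_inner E w \<sigma> u \<phi> x
       + \<rho> x * \<bar>u x\<bar> powr (p - 2) * u x * \<phi> x - \<psi> x (pos_part u x) * \<phi> x)"

definition Nehari ::
  "'v set set \<Rightarrow> ('v \<Rightarrow> 'v \<Rightarrow> real) \<Rightarrow> ('v \<Rightarrow> real) \<Rightarrow> real \<Rightarrow> ('v \<Rightarrow> real)
     \<Rightarrow> ('v \<Rightarrow> real \<Rightarrow> real) \<Rightarrow> ('v \<Rightarrow> real) set" where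
  "Nehari E w \<sigma> p \<rho> \<psi> = {u \<in> Hp E w \<sigma> p \<rho> - {\<lambda>x. 0}. J_deriv E w \<sigma> p \<rho> \<psi> u u = 0}"

definition solves_equation ::
  "'v set set \<Rightarrow> ('v \<Rightarrow> 'v \<Rightarrow> real) \<Rightarrow> ('v \<Rightarrow> real) \<Rightarrow> real \<Rightarrow> ('v \<Rightarrow> real)
     \<Rightarrow> ('v \<Rightarrow> real \<Rightarrow> real) \<Rightarrow> ('v \<Rightarrow> real) \<Rightarrow> bool" where
  "solves_equation E w \<sigma> p \<rho> \<psi> u \<longleftrightarrow>
     (\<forall>x. - p_Laplacian E w \<sigma> p u x + \<rho> x * \<bar>u x\<bar> powr (p - 2) * u x = \<psi> x (pos_part u x))"

text \<open>
  On \<open>real\<close>, \<open>INF\<close> is the infimum only of sets that are bounded below; hence the explicit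
  \<open>bdd_below\<close>.
\<close>

definition ground_state_solution ::
  "'v set set \<Rightarrow> ('v \<Rightarrow> 'v \<Rightarrow> real) \<Rightarrow> ('v \<Rightarrow> real) \<Rightarrow> real \<Rightarrow> ('v \<Rightarrow> real)
     \<Rightarrow> ('v \<Rightarrow> real \<Rightarrow> real) \<Rightarrow> ('v \<Rightarrow> real) \<Rightarrow> bool" where
  "ground_state_solution E w \<sigma> p \<rho> \<psi> u \<longleftrightarrow>
     u \<in> Nehari E w \<sigma> p \<rho> \<psi>
     \<and> bdd_below (J_fun E w \<sigma> p \<rho> \<psi> ` Nehari E w \<sigma> p \<rho> \<psi>)
     \<and> J_fun E w \<sigma> p \<rho> \<psi> u = (INF v\<in>Nehari E w \<sigma> p \<rho> \<psi>. J_fun E w \<sigma> p \<rho> \<psi> v)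
     \<and> solves_equation E w \<sigma> p \<rho> \<psi> u"

end

theory Submission
  imports Defs "HOL-Complex_Analysis.Great_Picard"
begin

text \<open>
  The ground state is a minimizer of \<open>J\<close> on the Nehari manifold, found by the direct method.

  The energy \<open>\<integral>(|\<nabla>u|\<^sup>p + \<rho>|u|\<^sup>p)d\<sigma>\<close> controls everything pointwise, because \<open>\<sigma>\<close> is bounded below.
  A function of finite energy tends to \<open>0\<close> at infinity, so subtracting its clipping to
  \<open>[-\<epsilon>, \<epsilon>]\<close> leaves a finitely supported function, and the clipping has small energy.  Hence \<open>H\<^sub>p\<close> is exactly the
  set of functions of finite energy (\<open>Hp_eq_finite_energy\<close>), and a pointwise limit of functions of bounded
  energy is again in \<open>H\<^sub>p\<close> by Fatou's lemma.  Moreover \<open>\<rho> \<rightarrow> \<infinity>\<close>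
  makes the \<open>L\<^sup>p\<close>-tails of such functions uniformly small (\<open>tail_Lp_le\<close>), and near \<open>0\<close>
  the nonlinearity is at most \<open>\<tau>s\<^bsup>p-1\<^esup>\<close>, so \<open>\<integral>\<Psi>(x,u\<^sup>+)d\<sigma>\<close> is continuous under pointwise
  convergence with bounded energies (\<open>F_integral_tendsto\<close>).

  On a ray \<open>t \<mapsto> tz\<close> with \<open>z\<^sup>+ \<noteq> 0\<close>, the derivative of \<open>J\<close> is \<open>t\<^bsup>p-1\<^esup>\<close> times a strictly decreasing function
  of \<open>t\<close> that changes sign.  So the ray meets the Nehari manifold at exactly one point, which is
  the maximum of \<open>J\<close> on it.  For a minimizing sequence \<open>u\<^sub>n\<close> in the manifold, the energies are bounded, and each
  \<open>u\<^sub>n\<close> reaches the height \<open>\<delta>\<close> below which \<open>\<psi>\<close> is dominated by \<open>\<lambda>\<^sub>p\<close>; this peak stays in a fixed finite set,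
  so the pointwise limit \<open>u\<close> of a subsequence has \<open>u\<^sup>+ \<noteq> 0\<close>.  If \<open>tu\<close> is in the manifold, then
  \<open>J(tu) \<le> liminf J(tu\<^sub>n) \<le> lim J(u\<^sub>n)\<close>, and \<open>tu\<close> is a minimizer (\<open>Nehari_minimizer_exists\<close>).

  A minimizer \<open>v\<close> solves the equation at \<open>x\<close> because perturbing it to \<open>v + s1\<^sub>x\<close> and projecting along rays
  back to the manifold cannot lower \<open>J\<close> (\<open>minimizer_solves\<close>).  Only finitely many terms of the energy depend
  on \<open>s\<close>, so no differentiation under an infinite sum occurs.  Finally \<open>v\<close> is positive by the
  strong minimum principle (\<open>solution_pos\<close>): at a minimum with value \<open>\<le> 0\<close> the equation forces all
  neighbours to share that value, which then spreads over the connected graph and contradicts \<open>v\<^sup>+ \<noteq> 0\<close>.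
\<close>

section \<open>Unordered sums of nonnegative functions\<close>

lemma nonneg_infsum_bounded:
  fixes f :: "'a \<Rightarrow> real"
  assumes "\<And>x. x \<in> A \<Longrightarrow> 0 \<le> f x" and "\<And>F. finite F \<Longrightarrow> F \<subseteq> A \<Longrightarrow> sum f F \<le> B"
  shows "f summable_on A" and "infsum f A \<le> B"
proof -
  show s: "f summable_on A"
    by (rule nonneg_bdd_above_summable_on[OF assms(1)]) (auto intro!: bdd_aboveI[of _ B] assms(2))
  show "infsum f A \<le> B"
    by (rule infsum_le_finite_sums[OF s assms(2)])
qed

lemma sum_le_infsum:
  fixes f :: "'a \<Rightarrow> real"
  assumes "f summable_on UNIV" "\<And>x. 0 \<le> f x" "finite F"
  shows "sum f F \<le> infsum f UNIV"
  using infsum_mono2[of f F UNIV] assms by simp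

lemma infsum_split:
  fixes f :: "'a \<Rightarrow> real"
  assumes "f summable_on UNIV" "finite S"
  shows "infsum f UNIV = sum f S + infsum f (- S)"
proof -
  have "infsum f (S \<union> - S) = infsum f S + infsum f (- S)"
    using assms by (intro infsum_Un_disjoint) (auto intro: summable_on_subset)
  then show ?thesis using assms by simp
qed

lemma infsum_diff_finite_change:
  fixes f g :: "'a \<Rightarrow> real"
  assumes "f summable_on UNIV" "g summable_on UNIV" "finite S" "\<And>x. x \<notin> S \<Longrightarrow> f x = g x"
  shows "infsum f UNIV - infsum g UNIV = (\<Sum>x\<in>S. f x - g x)"
proof -
  have "infsum f (- S) = infsum g (- S)" by (rule infsum_cong) (use assms in auto)
  then show ?thesis
    using infsum_split[OF assms(1,3)] infsum_split[OF assms(2,3)] by (simp add: sum_subtractf)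
qed

lemma summable_small_tail:
  fixes f :: "'a \<Rightarrow> real"
  assumes "f summable_on UNIV" "e > 0"
  shows "\<exists>S. finite S \<and> infsum f (- S) \<le> e"
proof -
  obtain S where S: "finite S" "dist (sum f S) (infsum f UNIV) \<le> e"
    using infsum_finite_approximation[OF assms] by auto
  then have "infsum f (- S) \<le> e"
    using infsum_split[OF assms(1) S(1)] by (auto simp: dist_real_def)
  then show ?thesis using S by blast
qed

text \<open>Off a finite set the sums contribute at most \<open>e\<close>, on it they converge term by term.  A
  dominating function is one source of uniform tails; a uniform bound on a weighted sum with a weight tending to
  infinity is another, for functions that may have no common majorant.\<close>
lemma infsum_tendsto_uniform_tails:
  fixes f :: "'b \<Rightarrow> 'a \<Rightarrow> real"
  assumes F: "F \<noteq> bot"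
    and lim: "\<And>x. ((\<lambda>n. f n x) \<longlongrightarrow> g x) F"
    and nn: "\<forall>\<^sub>F n in F. (\<forall>x. 0 \<le> f n x) \<and> f n summable_on UNIV"
    and tails: "\<And>e. e > 0 \<Longrightarrow> \<exists>S. finite S \<and> (\<forall>\<^sub>F n in F. infsum (f n) (- S) \<le> e)"
  shows "g summable_on UNIV" and "((\<lambda>n. infsum (f n) UNIV) \<longlongrightarrow> infsum g UNIV) F"
proof -
  have g0: "0 \<le> g x" for x
    by (rule tendsto_lowerbound[OF lim _ F]) (use nn in \<open>auto elim: eventually_mono\<close>)
  \<comment> \<open>By Fatou, the limit inherits every uniform bound on a tail.\<close>
  have tail_g: "g summable_on (- S) \<and> infsum g (- S) \<le> e"
    if S: "finite S" "\<forall>\<^sub>F n in F. infsum (f n) (- S) \<le> e" for S e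
  proof -
    have "sum g T \<le> e" if T: "finite T" "T \<subseteq> - S" for T
    proof (rule tendsto_upperbound[OF _ _ F])
      show "((\<lambda>n. sum (f n) T) \<longlongrightarrow> sum g T) F" by (intro tendsto_sum lim)
      show "\<forall>\<^sub>F n in F. sum (f n) T \<le> e"
        using S(2) nn
      proof eventually_elim
        case (elim n)
        have "f n summable_on - S" using elim by (auto intro: summable_on_subset)
        then have "sum (f n) T \<le> infsum (f n) (- S)"
          using infsum_mono2[of "f n" T "- S"] T elim by simp
        with elim show ?case by simp
      qed
    qed
    with nonneg_infsum_bounded[of "- S" g e] g0 show ?thesis by blast
  qed
  show gs: "g summable_on UNIV"
  proof -
    obtain S where "finite S" "\<forall>\<^sub>F n in F. infsum (f n) (- S) \<le> 1" using tails[of 1] by auto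
    with tail_g have "g summable_on S \<union> - S" by (intro summable_on_Un_disjoint) auto
    then show ?thesis by simp
  qed
  show "((\<lambda>n. infsum (f n) UNIV) \<longlongrightarrow> infsum g UNIV) F"
  proof (rule tendstoI)
    fix e :: real assume e: "e > 0"
    obtain S where S: "finite S" "\<forall>\<^sub>F n in F. infsum (f n) (- S) \<le> e / 3" using tails[of "e/3"] e by auto
    have "((\<lambda>n. sum (f n) S) \<longlongrightarrow> sum g S) F" by (intro tendsto_sum lim)
    then have "\<forall>\<^sub>F n in F. dist (sum (f n) S) (sum g S) < e / 3" using e by (intro tendstoD) auto
    then show "\<forall>\<^sub>F n in F. dist (infsum (f n) UNIV) (infsum g UNIV) < e"
      using S(2) nn
    proof eventually_elim
      case (elim n)
      have "0 \<le> infsum (f n) (- S)" "0 \<le> infsum g (- S)"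
        using elim g0 by (auto intro: infsum_nonneg)
      moreover have "infsum g (- S) \<le> e / 3" using tail_g S by blast
      moreover have "\<bar>sum (f n) S - sum g S\<bar> < e / 3" using elim by (simp add: dist_real_def)
      moreover have "infsum (f n) UNIV = sum (f n) S + infsum (f n) (- S)"
        using elim S(1) by (intro infsum_split) auto
      ultimately show ?case
        using elim infsum_split[OF gs S(1)] unfolding dist_real_def by linarith
    qed
  qed
qed

lemma infsum_tendsto_dominated:
  fixes f :: "'b \<Rightarrow> 'a \<Rightarrow> real"
  assumes F: "F \<noteq> bot"
    and lim: "\<And>x. ((\<lambda>n. f n x) \<longlongrightarrow> g x) F"
    and dom: "\<forall>\<^sub>F n in F. \<forall>x. 0 \<le> f n x \<and> f n x \<le> h x"
    and h: "h summable_on UNIV"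
  shows "((\<lambda>n. infsum (f n) UNIV) \<longlongrightarrow> infsum g UNIV) F"
proof (rule infsum_tendsto_uniform_tails(2)[OF F lim])
  have s: "f n summable_on UNIV" if "\<forall>x. 0 \<le> f n x \<and> f n x \<le> h x" for n
    using summable_on_comparison_test[OF h] that by blast
  show "\<forall>\<^sub>F n in F. (\<forall>x. 0 \<le> f n x) \<and> f n summable_on UNIV"
    using dom by eventually_elim (use s in blast)
  fix e :: real assume "e > 0"
  then obtain S where S: "finite S" "infsum h (- S) \<le> e" using summable_small_tail[OF h] by blast
  have "\<forall>\<^sub>F n in F. infsum (f n) (- S) \<le> e"
    using dom
  proof eventually_elim
    case (elim n)
    have "infsum (f n) (- S) \<le> infsum h (- S)"
      using elim s h by (intro infsum_mono) (auto intro: summable_on_subset)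
    with S show ?case by simp
  qed
  with S show "\<exists>S. finite S \<and> (\<forall>\<^sub>F n in F. infsum (f n) (- S) \<le> e)" by blast
qed

section \<open>Powers of seminorms\<close>

lemma powr_add_le:
  fixes a b p :: real
  assumes "0 \<le> a" "0 \<le> b" "p > 0"
  shows "(a + b) powr p \<le> 2 powr p * (a powr p + b powr p)"
proof -
  have "(a + b) powr p \<le> (2 * max a b) powr p" using assms by (intro powr_mono2) auto
  also have "\<dots> = 2 powr p * max a b powr p" using assms by (simp add: powr_mult)
  also have "\<dots> \<le> 2 powr p * (a powr p + b powr p)" by (intro mult_left_mono) (auto simp: max_def)
  finally show ?thesis .
qed

lemma tendsto_powr_abs:
  assumes "(f \<longlongrightarrow> l) F" "p > 0"
  shows "((\<lambda>n. \<bar>f n :: real\<bar> powr p) \<longlongrightarrow> \<bar>l\<bar> powr p) F"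
  using assms by (intro tendsto_powr2 tendsto_intros) auto

text \<open>At \<open>a = 0\<close> differentiability needs \<open>p > 1\<close>, and the value \<open>0 powr (p - 2) = 0\<close> makes
  the formula right there as well.\<close>
lemma DERIV_powr_abs:
  fixes a p :: real
  assumes "p > 1"
  shows "((\<lambda>s. \<bar>a + s\<bar> powr p / p) has_real_derivative \<bar>a\<bar> powr (p - 2) * a) (at 0)"
proof (cases "a = 0")
  case False
  have e: "\<bar>a\<bar> powr (p - 1) * sgn a = \<bar>a\<bar> powr (p - 2) * a"
  proof -
    have "\<bar>a\<bar> powr (p - 1) = \<bar>a\<bar> powr (p - 2) * \<bar>a\<bar>"
      using False powr_add[of "\<bar>a\<bar>" "p - 2" 1] by simp
    then show ?thesis by (simp add: mult.assoc abs_mult_sgn mult.commute[of _ "sgn a"] sgn_mult_abs)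
  qed
  have "((\<lambda>s. \<bar>a + s\<bar>) has_real_derivative sgn a) (at 0)"
  proof (cases "a > 0")
    case True
    have "((\<lambda>s. a + s) has_real_derivative sgn a) (at 0)" using True by (auto intro!: derivative_eq_intros)
    moreover have "\<forall>\<^sub>F s in nhds 0. a + s = \<bar>a + s\<bar>"
      using eventually_nhds_in_open[of "{-a<..}" "0::real"] True by (auto elim!: eventually_mono)
    ultimately show ?thesis by (rule iffD1[OF DERIV_cong_ev[OF refl _ refl], rotated])
  next
    case F: False
    have "((\<lambda>s. - (a + s)) has_real_derivative sgn a) (at 0)" using False F by (auto intro!: derivative_eq_intros)
    moreover have "\<forall>\<^sub>F s in nhds 0. - (a + s) = \<bar>a + s\<bar>"
      using eventually_nhds_in_open[of "{..<-a}" "0::real"] False F by (auto elim!: eventually_mono)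
    ultimately show ?thesis by (rule iffD1[OF DERIV_cong_ev[OF refl _ refl], rotated])
  qed
  from DERIV_powr[OF this _ DERIV_const, of p]
  have "((\<lambda>s. \<bar>a + s\<bar> powr p) has_real_derivative \<bar>a\<bar> powr p * (sgn a * p / \<bar>a\<bar>)) (at 0)"
    using False by simp
  moreover have "\<bar>a\<bar> powr p * (sgn a * p / \<bar>a\<bar>) = p * (\<bar>a\<bar> powr (p - 1) * sgn a)"
    using False by (simp add: powr_diff)
  ultimately have "((\<lambda>s. \<bar>a + s\<bar> powr p) has_real_derivative p * (\<bar>a\<bar> powr (p - 2) * a)) (at 0)"
    by (simp only: e)
  from DERIV_cdivide[OF this, of p] show ?thesis using assms by simp
next
  case True
  have "((\<lambda>s::real. \<bar>s\<bar> powr p / p / s) \<longlongrightarrow> 0) (at 0)"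
  proof (rule Lim_null_comparison)
    show "((\<lambda>s::real. \<bar>s\<bar> powr (p - 1) / p) \<longlongrightarrow> 0) (at 0)"
      using tendsto_powr_abs[of "\<lambda>s. s" 0 "at 0" "p - 1"] assms by (auto intro!: tendsto_eq_intros)
    show "\<forall>\<^sub>F s in at (0::real). norm (\<bar>s\<bar> powr p / p / s) \<le> \<bar>s\<bar> powr (p - 1) / p"
      using assms by (auto simp: eventually_at_filter powr_diff abs_mult field_simps)
  qed
  then show ?thesis using True by (simp add: DERIV_def)
qed

text \<open>For the gradient norm along a line \<open>u + s\<phi>\<close>, whose square is a quadratic \<open>q\<close> in \<open>s\<close>.  If
  \<open>q\<close> vanishes at \<open>0\<close>, being nonnegative it has no linear term, so its square root is a
  multiple of \<open>|s|\<close>, and the \<open>p\<close>-th power of that is flat at \<open>0\<close> as \<open>p > 1\<close>.\<close>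
lemma DERIV_sqrt_powr_quadratic:
  fixes q :: "real \<Rightarrow> real"
  assumes "p > 1" and q: "\<And>s. q s = A + 2 * B * s + C * s\<^sup>2" "\<And>s. 0 \<le> q s"
  shows "((\<lambda>s. sqrt (q s) powr p / p) has_real_derivative sqrt A powr (p - 2) * B) (at 0)"
proof (cases "A = 0")
  case False
  then have A: "A > 0" using q(2)[of 0] q(1)[of 0] by simp
  have d: "(q has_real_derivative 2 * B) (at 0)"
    unfolding q(1) by (auto intro!: derivative_eq_intros)
  have eq: "sqrt (q s) powr p / p = q s powr (p / 2) / p" for s
    using q(2)[of s] by (simp add: powr_half_sqrt[symmetric] powr_powr)
  have "((\<lambda>s. q s powr (p / 2)) has_real_derivative A powr (p / 2) * (2 * B * (p / 2) / A)) (at 0)"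
    using DERIV_powr[OF d _ DERIV_const, of "p / 2"] A q(1)[of 0] by simp
  from DERIV_cdivide[OF this, of p]
  have "((\<lambda>s. q s powr (p / 2) / p) has_real_derivative A powr (p / 2) * (2 * B * (p / 2) / A) / p) (at 0)" .
  moreover have "A powr (p / 2) * (2 * B * (p / 2) / A) / p = sqrt A powr (p - 2) * B"
  proof -
    have "sqrt A powr (p - 2) = A powr (p / 2) / A"
      using A by (simp add: powr_half_sqrt[symmetric] powr_powr left_diff_distrib powr_diff)
    then show ?thesis using assms(1) by simp
  qed
  ultimately show ?thesis by (simp only: eq)
next
  case True
  have B0: "B = 0"
  proof (rule ccontr)
    assume B: "B \<noteq> 0"
    have C: "C > 0"
    proof (rule ccontr)
      assume "\<not> C > 0"
      then have "C * B\<^sup>2 \<le> 0" by (simp add: mult_nonpos_nonneg)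
      moreover have "0 \<le> - 2 * B\<^sup>2 + C * B\<^sup>2" using q(2)[of "-B"] q(1)[of "-B"] True by (simp add: power2_eq_square)
      moreover have "B\<^sup>2 > 0" using B by simp
      ultimately show False by linarith
    qed
    \<comment> \<open>the minimum of \<open>2 B s + C s\<^sup>2\<close>\<close>
    have "q (- B / C) = - (B\<^sup>2 / C)" using C True
      by (simp add: q(1) power2_eq_square field_simps)
    moreover have "B\<^sup>2 / C > 0" using B C by simp
    ultimately show False using q(2)[of "-B/C"] by linarith
  qed
  have C: "C \<ge> 0" using q(2)[of 1] q(1)[of 1] True B0 by simp
  have "sqrt (q s) powr p / p = sqrt C powr p * (\<bar>0 + s\<bar> powr p / p)" for s
    using True B0 C by (simp add: q(1) real_sqrt_mult powr_mult)
  moreover have "((\<lambda>s. sqrt C powr p * (\<bar>0 + s\<bar> powr p / p)) has_real_derivative 0) (at 0)"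
    using DERIV_cmult[OF DERIV_powr_abs[OF assms(1), of 0], of "sqrt C powr p"] by simp
  ultimately show ?thesis using True B0 by (simp only:) simp
qed

section \<open>The energy space\<close>

text \<open>The growth of \<open>\<rho>\<close> at infinity enters only through the finiteness of its sublevel sets, which
  makes no reference to the graph distance.\<close>
locale energy_space =
  fixes E :: "'v set set" and w :: "'v \<Rightarrow> 'v \<Rightarrow> real" and \<sigma> \<rho> :: "'v \<Rightarrow> real" and \<sigma>\<^sub>0 p :: real
  assumes simple: "simple_graph E"
    and locally_finite: "locally_finite_graph E"
    and weight: "edge_weight E w"
    and sigma0_pos: "\<sigma>\<^sub>0 > 0"
    and sigma_ge: "\<sigma>\<^sub>0 \<le> \<sigma> x"
    and p_gt_1: "p > 1"
    and rho_nonneg: "0 \<le> \<rho> x"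
    and finite_sublevel: "finite {x. \<rho> x < R}"
begin

abbreviation "N \<equiv> nbrs E"
abbreviation "gn \<equiv> grad_norm E w \<sigma>"

lemma sigma_pos: "0 < \<sigma> x"
  using sigma0_pos sigma_ge[of x] by linarith

lemma sigma_nonneg [simp]: "0 \<le> \<sigma> x"
  using sigma_pos[of x] by simp

lemma p_pos: "p > 0" using p_gt_1 by simp

lemma finite_N [simp]: "finite (N x)"
  using locally_finite by (simp add: locally_finite_graph_def)

lemma N_sym: "y \<in> N x \<longleftrightarrow> x \<in> N y"
  by (simp add: nbrs_def insert_commute)

lemma N_irrefl: "x \<notin> N x"
  using simple by (auto simp: nbrs_def simple_graph_def)

lemma w_pos: "y \<in> N x \<Longrightarrow> 0 < w x y" and w_sym: "y \<in> N x \<Longrightarrow> w x y = w y x"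
  using weight by (auto simp: nbrs_def edge_weight_def)

lemma gn_eq_L2_set: "gn u x = L2_set (\<lambda>y. grad w \<sigma> u x y) (N x)"
proof -
  have "(\<Sum>y\<in>N x. (grad w \<sigma> u x y)\<^sup>2) = (\<Sum>y\<in>N x. 1 / (2 * \<sigma> x) * (w x y * (u y - u x)\<^sup>2))"
    using sigma_pos[of x] w_pos[of _ x] by (intro sum.cong) (auto simp: grad_def power_mult_distrib less_imp_le)
  then show ?thesis by (simp add: grad_norm_def L2_set_def sum_distrib_left)
qed

lemma gn_nonneg [simp]: "0 \<le> gn u x"
  by (simp add: gn_eq_L2_set)

lemma gn_squared: "(gn u x)\<^sup>2 = grad_inner E w \<sigma> u u x"
  by (simp add: gn_eq_L2_set L2_set_def grad_inner_def sum_nonneg power2_eq_square)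

lemma gn_add: "gn (\<lambda>x. u x + v x) x \<le> gn u x + gn v x"
proof -
  have "gn (\<lambda>x. u x + v x) x = L2_set (\<lambda>y. grad w \<sigma> u x y + grad w \<sigma> v x y) (N x)"
    by (simp add: gn_eq_L2_set grad_def algebra_simps)
  then show ?thesis by (simp add: gn_eq_L2_set L2_set_triangle_ineq)
qed

lemma gn_mono:
  assumes "\<And>y. \<bar>u y - u x\<bar> \<le> \<bar>v y - v x\<bar>"
  shows "gn u x \<le> gn v x"
  unfolding grad_norm_def using sigma_pos[of x] w_pos[of _ x] assms
  by (intro real_sqrt_le_mono mult_left_mono sum_mono) (auto simp: abs_le_square_iff[symmetric] less_imp_le)

lemma gn_scale: "gn (\<lambda>x. t * u x) x = \<bar>t\<bar> * gn u x"
proof -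
  have "(\<Sum>y\<in>N x. w x y * (t * u y - t * u x)\<^sup>2) = t\<^sup>2 * (\<Sum>y\<in>N x. w x y * (u y - u x)\<^sup>2)"
    by (simp add: sum_distrib_left power_mult_distrib mult.left_commute flip: right_diff_distrib)
  from arg_cong[OF this, of "\<lambda>S. sqrt (1 / (2 * \<sigma> x) * S)"]
  have "gn (\<lambda>x. t * u x) x = sqrt (t\<^sup>2 * (1 / (2 * \<sigma> x) * (\<Sum>y\<in>N x. w x y * (u y - u x)\<^sup>2)))"
    by (simp only: grad_norm_def mult.left_commute)
  also have "\<dots> = \<bar>t\<bar> * gn u x" unfolding grad_norm_def real_sqrt_mult by simp
  finally show ?thesis .
qed

lemma gn_tendsto:
  assumes "\<And>y. ((\<lambda>n. f n y) \<longlongrightarrow> u y) F"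
  shows "((\<lambda>n. gn (f n) x) \<longlongrightarrow> gn u x) F"
  unfolding grad_norm_def by (intro tendsto_intros assms)

lemma gn_eq_0: "gn u x = 0 \<Longrightarrow> y \<in> N x \<Longrightarrow> u y = u x"
  using w_pos[of y x] sigma_pos[of x] by (auto simp: gn_eq_L2_set L2_set_eq_0_iff grad_def)

definition energy_term :: "('v \<Rightarrow> real) \<Rightarrow> 'v \<Rightarrow> real" where
  "energy_term u x = \<sigma> x * (gn u x powr p + \<rho> x * \<bar>u x\<bar> powr p)"

definition energy :: "('v \<Rightarrow> real) \<Rightarrow> real" where
  "energy u = (\<Sum>\<^sub>\<infinity>x. energy_term u x)"

definition finite_energy :: "('v \<Rightarrow> real) \<Rightarrow> bool" where
  "finite_energy u \<longleftrightarrow> energy_term u summable_on UNIV"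

lemma energy_term_nonneg [simp]: "0 \<le> energy_term u x"
  using rho_nonneg[of x] by (simp add: energy_term_def)

lemma energy_nonneg [simp]: "0 \<le> energy u"
  by (simp add: energy_def infsum_nonneg)

lemma Hp_norm_eq: "Hp_norm E w \<sigma> p \<rho> u = energy u powr (1 / p)"
  by (simp add: Hp_norm_def integral_V_def energy_def energy_term_def)

lemma Hp_norm_powr: "Hp_norm E w \<sigma> p \<rho> u powr p = energy u"
  using p_pos by (simp add: Hp_norm_eq powr_powr)

lemma energy_term_scale: "0 \<le> t \<Longrightarrow> energy_term (\<lambda>x. t * u x) x = t powr p * energy_term u x"
  by (simp add: energy_term_def gn_scale powr_mult abs_mult algebra_simps)

lemma energy_scale: "0 \<le> t \<Longrightarrow> energy (\<lambda>x. t * u x) = t powr p * energy u"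
  by (simp add: energy_def energy_term_scale infsum_cmult_right')

lemma finite_energy_scale: "0 \<le> t \<Longrightarrow> finite_energy u \<Longrightarrow> finite_energy (\<lambda>x. t * u x)"
  unfolding finite_energy_def
  by (subst summable_on_cong[OF energy_term_scale]) (auto intro: summable_on_cmult_right)

lemma energy_term_uminus: "energy_term (\<lambda>x. - u x) x = energy_term u x"
  using gn_scale[of "-1" u x] by (simp add: energy_term_def)

text \<open>A triangle inequality up to a factor is enough for bounding and comparing energies, and it
  holds term by term.\<close>
lemma energy_term_add:
  "energy_term (\<lambda>x. u x + v x) x \<le> 2 powr p * (energy_term u x + energy_term v x)"
proof -
  have "gn (\<lambda>x. u x + v x) x powr p \<le> (gn u x + gn v x) powr p"
    using p_pos by (intro powr_mono2 gn_add) auto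
  also have "\<dots> \<le> 2 powr p * (gn u x powr p + gn v x powr p)"
    using p_pos by (intro powr_add_le) auto
  finally have 1: "gn (\<lambda>x. u x + v x) x powr p \<le> 2 powr p * (gn u x powr p + gn v x powr p)" .
  have "\<bar>u x + v x\<bar> powr p \<le> (\<bar>u x\<bar> + \<bar>v x\<bar>) powr p"
    using p_pos by (intro powr_mono2) auto
  also have "\<dots> \<le> 2 powr p * (\<bar>u x\<bar> powr p + \<bar>v x\<bar> powr p)"
    using p_pos by (intro powr_add_le) auto
  finally have 2: "\<rho> x * \<bar>u x + v x\<bar> powr p \<le> \<rho> x * (2 powr p * (\<bar>u x\<bar> powr p + \<bar>v x\<bar> powr p))"
    using rho_nonneg by (rule mult_left_mono)
  show ?thesis
    using mult_left_mono[OF add_mono[OF 1 2], of "\<sigma> x"] by (simp add: energy_term_def algebra_simps)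
qed

lemma finite_energy_add:
  assumes "finite_energy u" "finite_energy v"
  shows "finite_energy (\<lambda>x. u x + v x)"
    and "energy (\<lambda>x. u x + v x) \<le> 2 powr p * (energy u + energy v)"
proof -
  have s: "(\<lambda>x. 2 powr p * (energy_term u x + energy_term v x)) summable_on UNIV"
    using assms by (auto simp: finite_energy_def intro!: summable_on_cmult_right summable_on_add)
  then show f: "finite_energy (\<lambda>x. u x + v x)"
    unfolding finite_energy_def by (rule summable_on_comparison_test) (auto simp: energy_term_add)
  have "energy (\<lambda>x. u x + v x) \<le> (\<Sum>\<^sub>\<infinity>x. 2 powr p * (energy_term u x + energy_term v x))"
    unfolding energy_def using f s by (intro infsum_mono) (auto simp: finite_energy_def energy_term_add)
  also have "\<dots> = 2 powr p * (energy u + energy v)"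
    using assms by (simp add: energy_def infsum_cmult_right' infsum_add finite_energy_def)
  finally show "energy (\<lambda>x. u x + v x) \<le> 2 powr p * (energy u + energy v)" .
qed

lemma finite_energy_diff:
  assumes "finite_energy u" "finite_energy v"
  shows "energy (\<lambda>x. u x - v x) \<le> 2 powr p * (energy u + energy v)"
proof -
  have "finite_energy (\<lambda>x. - v x)" "energy (\<lambda>x. - v x) = energy v"
    using assms(2) summable_on_cong[of UNIV "energy_term (\<lambda>x. - v x)" "energy_term v"]
    by (simp_all add: finite_energy_def energy_def energy_term_uminus)
  with finite_energy_add(2)[OF assms(1), of "\<lambda>x. - v x"] show ?thesis by simp
qed

lemma energy_term_tendsto:
  assumes "\<And>y. ((\<lambda>n. f n y) \<longlongrightarrow> u y) F"
  shows "((\<lambda>n. energy_term (f n) x) \<longlongrightarrow> energy_term u x) F"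
  unfolding energy_term_def using p_pos
  by (intro tendsto_intros tendsto_powr_abs assms tendsto_powr2 gn_tendsto) auto

lemma C_c_finite_energy:
  assumes "u \<in> C_c"
  shows "finite_energy u"
proof -
  let ?S = "{x. u x \<noteq> 0} \<union> (\<Union>x\<in>{x. u x \<noteq> 0}. N x)"
  have S: "finite ?S" using assms by (simp add: C_c_def)
  have "energy_term u x = 0" if "x \<notin> ?S" for x
  proof -
    have "u x = 0" "\<And>y. y \<in> N x \<Longrightarrow> u y = 0" using that N_sym by auto
    then show ?thesis using p_pos by (simp add: energy_term_def grad_norm_def)
  qed
  then have "energy_term u summable_on ?S \<longleftrightarrow> energy_term u summable_on UNIV"
    by (intro summable_on_cong_neutral) auto
  with S show ?thesis unfolding finite_energy_def by simp
qed

lemma fatou: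
  assumes "\<And>F. finite F \<Longrightarrow> sum (energy_term u) F \<le> B"
  shows "finite_energy u" "energy u \<le> B"
  using nonneg_infsum_bounded[of UNIV "energy_term u" B] assms
  by (auto simp: finite_energy_def energy_def)

text \<open>Fatou's lemma: energy is lower semicontinuous under pointwise convergence, since
  each of its nonnegative terms depends continuously on finitely many values of the function.\<close>
lemma fatou_lim:
  assumes lim: "\<And>x. (\<lambda>n. f n x) \<longlonglongrightarrow> u x"
    and f: "\<And>n. finite_energy (f n)" "\<And>n. energy (f n) \<le> B"
  shows "finite_energy u" "energy u \<le> B"
proof -
  have "sum (energy_term u) F \<le> B" if F: "finite F" for F
  proof (rule LIMSEQ_le_const2)
    show "(\<lambda>n. sum (energy_term (f n)) F) \<longlonglongrightarrow> sum (energy_term u) F"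
      by (intro tendsto_sum energy_term_tendsto lim)
    have "sum (energy_term (f n)) F \<le> B" for n
      using sum_le_infsum[of "energy_term (f n)" F] f[of n] F
      by (auto simp: finite_energy_def energy_def)
    then show "\<exists>N. \<forall>n\<ge>N. sum (energy_term (f n)) F \<le> B" by blast
  qed
  then show "finite_energy u" "energy u \<le> B" using fatou by blast+
qed

lemma energy_term_le: "finite_energy u \<Longrightarrow> energy_term u x \<le> energy u"
  using sum_le_infsum[of "energy_term u" "{x}"] by (simp add: finite_energy_def energy_def)

lemma weighted_powr_le_energy_term:
  "\<rho> x \<ge> R \<Longrightarrow> R * (\<sigma> x * \<bar>u x\<bar> powr p) \<le> energy_term u x"
proof -
  assume "\<rho> x \<ge> R"
  then have "R * \<bar>u x\<bar> powr p \<le> gn u x powr p + \<rho> x * \<bar>u x\<bar> powr p"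
    by (simp add: add_increasing mult_right_mono)
  from mult_left_mono[OF this, of "\<sigma> x"] show ?thesis by (simp add: energy_term_def mult.left_commute)
qed

lemma powr_small_off_sublevel:
  assumes u: "finite_energy u" "energy u \<le> K" and "R > 0" "\<rho> x \<ge> R"
  shows "\<bar>u x\<bar> powr p \<le> K / (\<sigma>\<^sub>0 * R)"
proof -
  have "R * (\<sigma>\<^sub>0 * \<bar>u x\<bar> powr p) \<le> R * (\<sigma> x * \<bar>u x\<bar> powr p)"
    using assms(3) sigma_ge by (intro mult_left_mono mult_right_mono) auto
  also have "\<dots> \<le> K"
    using weighted_powr_le_energy_term[OF assms(4), of u] energy_term_le[OF u(1), of x] u(2) by linarith
  finally show ?thesis using assms(3) sigma0_pos by (simp add: field_simps)
qed

text \<open>A single term of the energy bounds \<open>\<rho>(x)\<sigma>\<^sub>0|u(x)|\<^sup>p\<close>; so where \<open>\<rho>\<close> is large, \<open>|u|\<close> is small, with a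
  threshold that depends on the energy bound only.\<close>
lemma uniformly_small_at_infinity:
  assumes "d > 0" "0 \<le> K"
  obtains R where "R > 0"
    "\<And>u x. finite_energy u \<Longrightarrow> energy u \<le> K \<Longrightarrow> \<rho> x \<ge> R \<Longrightarrow> \<bar>u x\<bar> < d"
proof
  define R where "R = (K + 1) / (\<sigma>\<^sub>0 * d powr p)"
  show R: "R > 0" using assms sigma0_pos by (simp add: R_def)
  fix u x assume a: "finite_energy u" "energy u \<le> K" "\<rho> x \<ge> R"
  have "\<bar>u x\<bar> powr p \<le> K / (\<sigma>\<^sub>0 * R)" by (rule powr_small_off_sublevel[OF a(1,2) R a(3)])
  also have "\<dots> = d powr p * (K / (K + 1))" using assms sigma0_pos by (simp add: R_def)
  also have "\<dots> < d powr p" using assms by (simp add: mult_less_cancel_left1 field_simps)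
  finally show "\<bar>u x\<bar> < d"
    using powr_less_cancel2[of p "\<bar>u x\<bar>" d] assms p_pos by (metis abs_ge_zero less_eq_real_def not_less powr_mono2)
qed

lemma finite_superlevel:
  assumes "finite_energy u" "d > 0"
  shows "finite {x. \<bar>u x\<bar> \<ge> d}"
proof -
  obtain R where "\<And>x. \<rho> x \<ge> R \<Longrightarrow> \<bar>u x\<bar> < d"
    using uniformly_small_at_infinity[OF assms(2) energy_nonneg[of u]] assms(1) by (metis order_refl)
  then have "{x. \<bar>u x\<bar> \<ge> d} \<subseteq> {x. \<rho> x < R}" by (force simp: not_less[symmetric])
  then show ?thesis using finite_sublevel finite_subset by blast
qed

definition clip :: "real \<Rightarrow> real \<Rightarrow> real" where
  "clip e r = max (- e) (min e r)"

lemma clip_lipschitz: "\<bar>clip e r - clip e s\<bar> \<le> \<bar>r - s\<bar>"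
  by (auto simp: clip_def max_def min_def)

lemma clip_abs_le: "e \<ge> 0 \<Longrightarrow> \<bar>clip e r\<bar> \<le> \<bar>r\<bar>" and clip_bound: "e \<ge> 0 \<Longrightarrow> \<bar>clip e r\<bar> \<le> e"
  by (auto simp: clip_def max_def min_def)

lemma energy_term_clip_le:
  assumes "e \<ge> 0" shows "energy_term (\<lambda>x. clip e (u x)) x \<le> energy_term u x"
  unfolding energy_term_def using p_pos assms rho_nonneg[of x]
  by (intro mult_left_mono add_mono powr_mono2 gn_mono clip_lipschitz clip_abs_le) auto

text \<open>Limits of Cauchy sequences in \<open>C\<^sub>c\<close> have finite energy by Fatou.  Conversely, \<open>u\<close> minus its
  clipping at height \<open>\<epsilon>\<close> lives on the finite set \<open>{|u| > \<epsilon>}\<close>.  Clipping is \<open>1\<close>-Lipschitz, so the energy terms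
  of the clipped function are dominated by those of \<open>u\<close>, and they vanish as \<open>\<epsilon> \<rightarrow> 0\<close>.\<close>
lemma Hp_eq_finite_energy: "u \<in> Hp E w \<sigma> p \<rho> \<longleftrightarrow> finite_energy u"
proof
  assume "u \<in> Hp E w \<sigma> p \<rho>"
  then obtain f where f: "\<And>n. f n \<in> C_c"
      "\<And>e. e > 0 \<Longrightarrow> \<exists>N. \<forall>m\<ge>N. \<forall>n\<ge>N. Hp_norm E w \<sigma> p \<rho> (\<lambda>x. f m x - f n x) < e"
      "\<And>x. (\<lambda>n. f n x) \<longlonglongrightarrow> u x"
    unfolding Hp_def by blast
  obtain M where M: "\<And>n. n \<ge> M \<Longrightarrow> Hp_norm E w \<sigma> p \<rho> (\<lambda>x. f n x - f M x) < 1"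
    using f(2)[of 1] by auto
  have fin: "finite_energy (f n)" for n using f(1) C_c_finite_energy by blast
  have "energy (f (n + M)) \<le> 2 powr p * (1 + energy (f M))" for n
  proof -
    let ?d = "\<lambda>x. f (n + M) x - f M x"
    have "finite {x. ?d x \<noteq> 0}"
      by (rule finite_subset[of _ "{x. f (n + M) x \<noteq> 0} \<union> {x. f M x \<noteq> 0}"])
        (use f(1) in \<open>auto simp: C_c_def\<close>)
    then have d: "finite_energy ?d" by (intro C_c_finite_energy) (simp add: C_c_def)
    have "Hp_norm E w \<sigma> p \<rho> ?d powr p \<le> 1 powr p"
      using M[of "n + M"] p_pos by (intro powr_mono2) (auto simp: Hp_norm_eq)
    then have "energy ?d \<le> 1" by (simp add: Hp_norm_powr)
    then have "2 powr p * (energy ?d + energy (f M)) \<le> 2 powr p * (1 + energy (f M))"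
      by (intro mult_left_mono) auto
    with finite_energy_add(2)[OF d fin[of M]]
    have "energy (\<lambda>x. ?d x + f M x) \<le> 2 powr p * (1 + energy (f M))" by (rule order_trans)
    then show ?thesis by simp
  qed
  then show "finite_energy u"
    using fatou_lim(1)[of "\<lambda>n. f (n + M)" u] fin LIMSEQ_ignore_initial_segment[OF f(3)] by blast
next
  assume u: "finite_energy u"
  define c where "c n x = clip (1 / real (Suc n)) (u x)" for n x
  have c0: "(\<lambda>n. c n x) \<longlonglongrightarrow> 0" for x
  proof (rule Lim_null_comparison)
    show "(\<lambda>n. 1 / real (Suc n)) \<longlonglongrightarrow> 0" by (rule LIMSEQ_Suc[OF lim_1_over_n])
    show "\<forall>\<^sub>F n in sequentially. norm (c n x) \<le> 1 / real (Suc n)"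
      unfolding c_def real_norm_def by (intro always_eventually allI clip_bound) simp
  qed
  have le: "energy_term (c n) x \<le> energy_term u x" for n x
    unfolding c_def by (rule energy_term_clip_le) simp
  have cfin: "finite_energy (c n)" for n
    unfolding finite_energy_def
    by (rule summable_on_comparison_test[OF u[unfolded finite_energy_def]]) (auto simp: le)
  have et0: "(\<lambda>n. energy_term (c n) x) \<longlonglongrightarrow> 0" for x
    using energy_term_tendsto[of c "\<lambda>_. 0", OF c0] p_pos by (simp add: energy_term_def grad_norm_def)
  have "(\<lambda>n. infsum (energy_term (c n)) UNIV) \<longlonglongrightarrow> infsum (\<lambda>x :: 'v. 0) UNIV"
    by (rule infsum_tendsto_dominated[where f = "\<lambda>n. energy_term (c n)" and h = "energy_term u"])
      (use u in \<open>auto simp: le et0 finite_energy_def\<close>)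
  then have lim: "(\<lambda>n. energy (c n)) \<longlonglongrightarrow> 0" by (simp add: energy_def)
  define f where "f n x = u x - c n x" for n x
  have "f n \<in> C_c" for n
  proof -
    have "{x. f n x \<noteq> 0} \<subseteq> {x. \<bar>u x\<bar> \<ge> 1 / real (Suc n)}"
      by (auto simp: f_def c_def clip_def max_def min_def split: if_splits)
    then show ?thesis using finite_superlevel[OF u, of "1 / real (Suc n)"] finite_subset by (auto simp: C_c_def)
  qed
  moreover have "\<exists>M. \<forall>m\<ge>M. \<forall>n\<ge>M. Hp_norm E w \<sigma> p \<rho> (\<lambda>x. f m x - f n x) < e" if e: "e > 0" for e
  proof -
    define d where "d = e powr p / (2 powr p * 2)"
    have "d > 0" using e by (simp add: d_def)
    then obtain M where M: "\<And>n. n \<ge> M \<Longrightarrow> energy (c n) < d"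
      using LIMSEQ_D[OF lim, of d] by auto
    have "Hp_norm E w \<sigma> p \<rho> (\<lambda>x. f m x - f n x) < e" if "m \<ge> M" "n \<ge> M" for m n
    proof -
      have "energy (\<lambda>x. f m x - f n x) \<le> 2 powr p * (energy (c n) + energy (c m))"
        using finite_energy_diff[OF cfin[of n] cfin[of m]] by (simp add: f_def)
      also have "\<dots> < 2 powr p * (d + d)" using M that by (intro mult_strict_left_mono add_strict_mono) auto
      also have "\<dots> = e powr p" by (simp add: d_def)
      finally have "energy (\<lambda>x. f m x - f n x) powr (1 / p) < (e powr p) powr (1 / p)"
        using p_pos by (intro powr_less_mono2) auto
      then show ?thesis using e p_pos by (simp add: Hp_norm_eq powr_powr)
    qed
    then show ?thesis by blast
  qed
  moreover have "(\<lambda>n. f n x) \<longlonglongrightarrow> u x" for x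
    unfolding f_def using tendsto_diff[OF tendsto_const c0[of x], of "u x"] by simp
  ultimately show "u \<in> Hp E w \<sigma> p \<rho>" unfolding Hp_def by blast
qed

lemma summable_Lp:
  assumes "finite_energy u"
  shows "(\<lambda>x. \<sigma> x * \<bar>u x\<bar> powr p) summable_on UNIV"
proof -
  let ?S = "{x. \<rho> x < 1}"
  have "(\<lambda>x. \<sigma> x * \<bar>u x\<bar> powr p) summable_on - ?S"
  proof (rule summable_on_comparison_test)
    show "energy_term u summable_on - ?S" using assms by (auto simp: finite_energy_def intro: summable_on_subset)
    show "\<sigma> x * \<bar>u x\<bar> powr p \<le> energy_term u x" if "x \<in> - ?S" for x
      using weighted_powr_le_energy_term[of 1 x u] that by auto
  qed auto
  then have "(\<lambda>x. \<sigma> x * \<bar>u x\<bar> powr p) summable_on ?S \<union> - ?S"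
    using finite_sublevel by (intro summable_on_Un_disjoint) auto
  then show ?thesis by simp
qed

text \<open>Replaces the compact embedding of \<open>H\<^sub>p\<close> into \<open>L\<^sup>p\<close>: the bound on the tail is uniform on
  sets of bounded energy.\<close>
lemma tail_Lp_le:
  assumes u: "finite_energy u" and R: "R > 0"
  shows "(\<Sum>\<^sub>\<infinity>x\<in>- {x. \<rho> x < R}. \<sigma> x * \<bar>u x\<bar> powr p) \<le> energy u / R"
proof -
  let ?A = "- {x. \<rho> x < R}"
  have "(\<Sum>\<^sub>\<infinity>x\<in>?A. \<sigma> x * \<bar>u x\<bar> powr p) \<le> (\<Sum>\<^sub>\<infinity>x\<in>?A. (1 / R) * energy_term u x)"
  proof (rule infsum_mono)
    show "\<sigma> x * \<bar>u x\<bar> powr p \<le> (1 / R) * energy_term u x" if "x \<in> ?A" for x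
      using weighted_powr_le_energy_term[of R x u] that R by (auto simp: field_simps)
    show "(\<lambda>x. (1 / R) * energy_term u x) summable_on ?A"
      using u by (intro summable_on_cmult_right) (auto simp: finite_energy_def intro: summable_on_subset)
  qed (use summable_Lp[OF u] in \<open>auto intro: summable_on_subset\<close>)
  also have "\<dots> = (1 / R) * (\<Sum>\<^sub>\<infinity>x\<in>?A. energy_term u x)" by (rule infsum_cmult_right')
  also have "\<dots> \<le> (1 / R) * energy u"
    unfolding energy_def using u R
    by (intro mult_left_mono infsum_mono2) (auto simp: finite_energy_def intro: summable_on_subset)
  finally show ?thesis by simp
qed

text \<open>Multiplied out, the variational definition of \<open>\<lambda>\<^sub>p\<close> holds for \<open>u = 0\<close> as well.\<close>
lemma Lp_powr_le:
  assumes u: "finite_energy u"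
  shows "lambda_p E w \<sigma> p \<rho> * (\<Sum>\<^sub>\<infinity>x. \<sigma> x * \<bar>u x\<bar> powr p) \<le> energy u"
proof (cases "u = (\<lambda>x. 0)")
  case False
  let ?L = "\<Sum>\<^sub>\<infinity>x. \<sigma> x * \<bar>u x\<bar> powr p"
  obtain x where x: "u x \<noteq> 0" using False by auto
  have "0 < \<sigma> x * \<bar>u x\<bar> powr p" using x sigma_pos by simp
  also have "\<dots> \<le> ?L" using sum_le_infsum[OF summable_Lp[OF u], of "{x}"] by simp
  finally have L: "?L > 0" .
  have "lambda_p E w \<sigma> p \<rho> \<le> Hp_norm E w \<sigma> p \<rho> u powr p / Lp_norm \<sigma> p u powr p"
    unfolding lambda_p_def
  proof (rule cINF_lower)
    show "bdd_below ((\<lambda>u. Hp_norm E w \<sigma> p \<rho> u powr p / Lp_norm \<sigma> p u powr p) ` (Hp E w \<sigma> p \<rho> - {\<lambda>x. 0}))"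
      by (rule bdd_belowI2[of _ 0]) simp
  qed (use u False in \<open>auto simp: Hp_eq_finite_energy\<close>)
  also have "Lp_norm \<sigma> p u powr p = ?L"
    using p_pos L by (simp add: Lp_norm_def integral_V_def powr_powr)
  finally show ?thesis using L by (simp add: Hp_norm_powr field_simps)
qed (simp add: p_pos)

lemma countable_UNIV: "countable (UNIV :: 'v set)"
proof -
  have "(UNIV :: 'v set) = (\<Union>n::nat. {x. \<rho> x < real n})"
    by (auto intro: reals_Archimedean2)
  then show ?thesis by (metis countable_UN countable_finite finite_sublevel uncountable_def countableI_type)
qed

end

section \<open>The nonlinearity\<close>

locale superlinear_problem = energy_space E w \<sigma> \<rho> \<sigma>\<^sub>0 p
  for E :: "'v set set" and w :: "'v \<Rightarrow> 'v \<Rightarrow> real" and \<sigma> \<rho> :: "'v \<Rightarrow> real" and \<sigma>\<^sub>0 p :: real +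
  fixes \<psi> :: "'v \<Rightarrow> real \<Rightarrow> real" and \<alpha> \<tau> \<delta> :: real
  assumes connected: "connected_graph E"
    and psi_zero: "\<psi> x 0 = 0"
    and psi_cont: "continuous_on {0..} (\<psi> x)"
    and alpha_gt: "\<alpha> > p"
    and superlinear: "s > 0 \<Longrightarrow> 0 < \<alpha> * primitive \<psi> x s \<and> \<alpha> * primitive \<psi> x s \<le> s * \<psi> x s"
    and tau_less: "\<tau> < lambda_p E w \<sigma> p \<rho>"
    and delta_pos: "\<delta> > 0"
    and psi_small: "0 < s \<Longrightarrow> s < \<delta> \<Longrightarrow> \<psi> x s \<le> \<tau> * s powr (p - 1)"
    and quotient_mono: "strict_mono_on {0<..} (\<lambda>s. \<psi> x s / s powr (p - 1))"
begin

text \<open>Extended by zero to negative arguments, the nonlinearity absorbs the positive part: \<open>f\<close> and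
  its antiderivative \<open>F\<close> satisfy \<open>f x (u x) = \<psi>(x,u\<^sup>+)\<close> and \<open>F x (u x) = \<Psi>(x,u\<^sup>+)\<close>.\<close>
definition f :: "'v \<Rightarrow> real \<Rightarrow> real" where "f x r = \<psi> x (max r 0)"

definition F :: "'v \<Rightarrow> real \<Rightarrow> real" where "F x r = primitive \<psi> x (max r 0)"

lemma alpha_gt_1: "\<alpha> > 1" using alpha_gt p_gt_1 by simp

lemma F_nonpos [simp]: "r \<le> 0 \<Longrightarrow> F x r = 0"
  by (simp add: F_def primitive_def max_def)

lemma f_nonpos [simp]: "r \<le> 0 \<Longrightarrow> f x r = 0"
  by (simp add: f_def psi_zero max_def)

lemma F_pos: "r > 0 \<Longrightarrow> 0 < F x r"
  using superlinear[of r x] alpha_gt_1 by (auto simp: F_def zero_less_mult_iff)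

lemma F_nonneg [simp]: "0 \<le> F x r"
  using F_pos[of r x] by (cases "r > 0") auto

lemma alpha_F_le: "\<alpha> * F x r \<le> f x r * r"
proof (cases "r > 0")
  case True
  then show ?thesis using superlinear[of r x] by (simp add: F_def f_def mult.commute)
qed simp

lemma f_pos: "r > 0 \<Longrightarrow> 0 < f x r"
proof -
  assume r: "r > 0"
  have "0 < \<alpha> * F x r" using F_pos[OF r] alpha_gt_1 by simp
  then have "0 < f x r * r" using alpha_F_le[of x r] by linarith
  then show ?thesis using r by (simp add: zero_less_mult_iff)
qed

lemma f_nonneg [simp]: "0 \<le> f x r"
  using f_pos[of r x] by (cases "r > 0") auto

lemma f_mult_nonneg [simp]: "0 \<le> f x r * r"
  using f_pos[of r x] by (cases "r > 0") auto

lemma F_le: "F x r \<le> f x r * r"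
  using alpha_F_le[of x r] mult_right_mono[of 1 \<alpha> "F x r"] alpha_gt_1 by simp

lemma isCont_f: "isCont (f x) r"
proof -
  have "continuous_on UNIV (\<lambda>r. \<psi> x (max r 0))"
    by (rule continuous_on_compose2[OF psi_cont]) (auto intro!: continuous_intros)
  then show ?thesis unfolding f_def[abs_def] by (simp add: continuous_on_eq_continuous_at)
qed

lemma DERIV_F: "(F x has_real_derivative f x r) (at r)"
proof -
  define M where "M = \<bar>r\<bar> + 1"
  have cont: "continuous_on A (f x)" for A by (simp add: continuous_at_imp_continuous_on isCont_f)
  \<comment> \<open>an integral that starts left of \<open>0\<close> is differentiable at \<open>0\<close> from both sides\<close>
  have F_int: "F x s = integral {-M..s} (f x)" if "s \<in> {-M..M}" for s
  proof (cases "s \<ge> 0")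
    case True
    have "integral {-M..s} (f x) = integral {-M..0} (f x) + integral {0..s} (f x)"
      using that True by (intro Henstock_Kurzweil_Integration.integral_combine[symmetric]
          integrable_continuous_real cont) (auto simp: M_def)
    also have "integral {-M..0} (f x) = integral {-M..0} (\<lambda>_. 0 :: real)"
      by (rule Henstock_Kurzweil_Integration.integral_cong) auto
    also have "integral {0..s} (f x) = integral {0..s} (\<psi> x)"
      by (rule Henstock_Kurzweil_Integration.integral_cong) (auto simp: f_def max_def)
    finally show ?thesis using True by (simp add: F_def primitive_def max_def)
  next
    case False
    have "integral {-M..s} (f x) = integral {-M..s} (\<lambda>_. 0 :: real)"
      by (rule Henstock_Kurzweil_Integration.integral_cong) (use False in auto)
    then show ?thesis using False by simp
  qed
  have "((\<lambda>s. integral {-M..s} (f x)) has_real_derivative f x r) (at r within {-M..M})"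
    by (rule integral_has_real_derivative[OF cont]) (auto simp: M_def)
  moreover have "at r within {-M..M} = at r" by (rule at_within_Icc_at) (auto simp: M_def)
  ultimately have d: "((\<lambda>s. integral {-M..s} (f x)) has_real_derivative f x r) (at r)" by simp
  have "\<forall>\<^sub>F s in nhds r. s \<in> {-M<..<M}"
    by (intro eventually_nhds_in_open) (auto simp: M_def)
  then have "\<forall>\<^sub>F s in nhds r. F x s = integral {-M..s} (f x)"
    by eventually_elim (auto intro: F_int)
  from iffD2[OF DERIV_cong_ev[OF refl this refl] d] show ?thesis .
qed

lemma isCont_F: "isCont (F x) r"
  using DERIV_F by (rule DERIV_isCont)

lemma f_quotient_less:
  assumes "0 < a" "a < b"
  shows "f x a / a powr (p - 1) < f x b / b powr (p - 1)"
  using strict_mono_onD[OF quotient_mono[of x], of a b] assms by (simp add: f_def)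

lemma f_quotient_le:
  assumes "0 < a" "a \<le> b"
  shows "f x a / a powr (p - 1) \<le> f x b / b powr (p - 1)"
  using f_quotient_less[of a b x] assms by (cases "a = b") auto

lemma f_mono: "a \<le> b \<Longrightarrow> f x a \<le> f x b"
proof (cases "a > 0")
  case True
  assume ab: "a \<le> b"
  have "f x a = f x a / a powr (p - 1) * a powr (p - 1)" using True by simp
  also have "\<dots> \<le> f x b / b powr (p - 1) * b powr (p - 1)"
    using True ab p_gt_1 by (intro mult_mono f_quotient_le powr_mono2) auto
  also have "\<dots> = f x b" using True ab by simp
  finally show ?thesis .
qed simp

text \<open>\<open>F\<close> is convex, because \<open>f\<close> is nondecreasing.\<close>
lemma F_above_tangent: "F x a + f x a * (r - a) \<le> F x r"
proof (cases r a rule: linorder_cases)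
  case less
  from MVT2[OF this DERIV_F] obtain z where z: "r < z" "z < a" "F x a - F x r = (a - r) * f x z" by blast
  have "(a - r) * f x z \<le> (a - r) * f x a" using less z by (intro mult_left_mono f_mono) auto
  with z show ?thesis by (simp add: algebra_simps)
next
  case greater
  from MVT2[OF this DERIV_F] obtain z where z: "a < z" "z < r" "F x r - F x a = (r - a) * f x z" by blast
  have "(r - a) * f x a \<le> (r - a) * f x z" using greater z by (intro mult_left_mono f_mono) auto
  with z show ?thesis by (simp add: algebra_simps)
qed simp

text \<open>The derivative of \<open>F\<close> is \<open>r\<^bsup>p-1\<^esup>\<close> times a nondecreasing quotient, so the increment of \<open>F\<close> is that of
  \<open>r\<^sup>p / p\<close> times a factor between the values of the quotient at the end points.\<close>
lemma F_increment_bounds: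
  assumes "0 < a" "a \<le> b"
  shows "f x a / a powr (p - 1) * ((b powr p - a powr p) / p) \<le> F x b - F x a"
    and "F x b - F x a \<le> f x b / b powr (p - 1) * ((b powr p - a powr p) / p)"
proof -
  have d: "((\<lambda>r. c * (r powr p / p) - F x r) has_real_derivative c * r powr (p - 1) - f x r) (at r)"
    if "r > 0" for r c
    using that p_gt_1 by (auto intro!: derivative_eq_intros DERIV_F simp: powr_diff)
  have fr: "f x r = f x r / r powr (p - 1) * r powr (p - 1)" if "r > 0" for r using that by simp
  let ?a = "f x a / a powr (p - 1)" and ?b = "f x b / b powr (p - 1)"
  have "?b * (a powr p / p) - F x a \<le> ?b * (b powr p / p) - F x b"
  proof (rule DERIV_nonneg_imp_nondecreasing[OF assms(2)])
    fix r assume r: "a \<le> r" "r \<le> b"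
    then have "f x r / r powr (p - 1) * r powr (p - 1) \<le> ?b * r powr (p - 1)"
      using assms by (intro mult_right_mono f_quotient_le) auto
    with fr[of r] d[of r ?b] r assms
    show "\<exists>y. ((\<lambda>r. ?b * (r powr p / p) - F x r) has_real_derivative y) (at r) \<and> 0 \<le> y"
      by (intro exI[of _ "?b * r powr (p - 1) - f x r"]) simp
  qed
  then show "F x b - F x a \<le> ?b * ((b powr p - a powr p) / p)"
    by (simp add: right_diff_distrib diff_divide_distrib)
  have "?a * (a powr p / p) - F x a \<ge> ?a * (b powr p / p) - F x b"
  proof (rule DERIV_nonpos_imp_nonincreasing[OF assms(2)])
    fix r assume r: "a \<le> r" "r \<le> b"
    then have "?a * r powr (p - 1) \<le> f x r / r powr (p - 1) * r powr (p - 1)"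
      using assms by (intro mult_right_mono f_quotient_le) auto
    with fr[of r] d[of r ?a] r assms
    show "\<exists>y. ((\<lambda>r. ?a * (r powr p / p) - F x r) has_real_derivative y) (at r) \<and> y \<le> 0"
      by (intro exI[of _ "?a * r powr (p - 1) - f x r"]) simp
  qed
  then show "?a * ((b powr p - a powr p) / p) \<le> F x b - F x a"
    by (simp add: right_diff_distrib diff_divide_distrib)
qed

text \<open>Superlinearity says that \<open>F x r / r\<^sup>\<alpha>\<close> is nondecreasing.\<close>
lemma F_growth:
  assumes "s > 0" "t \<ge> 1"
  shows "t powr \<alpha> * F x s \<le> F x (t * s)"
proof -
  have "F x s * s powr (- \<alpha>) \<le> F x (t * s) * (t * s) powr (- \<alpha>)"
  proof (rule DERIV_nonneg_imp_nondecreasing[where f = "\<lambda>r. F x r * r powr (- \<alpha>)"])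
    show "s \<le> t * s" using assms by simp
    fix r assume "s \<le> r" "r \<le> t * s"
    then have r: "r > 0" using assms by simp
    let ?y = "f x r * r powr (- \<alpha>) + F x r * (- \<alpha> * r powr (- \<alpha> - 1))"
    have "((\<lambda>r. F x r * r powr (- \<alpha>)) has_real_derivative ?y) (at r)"
      using r by (auto intro!: derivative_eq_intros DERIV_F simp: powr_diff)
    moreover have "?y = r powr (- \<alpha> - 1) * (f x r * r - \<alpha> * F x r)"
      using r by (simp add: powr_diff field_simps)
    then have "?y \<ge> 0" using alpha_F_le[of x r] by simp
    ultimately show "\<exists>y. ((\<lambda>r. F x r * r powr (- \<alpha>)) has_real_derivative y) (at r) \<and> 0 \<le> y" by blast
  qed
  then have "F x s * s powr (- \<alpha>) * (t powr \<alpha> * s powr \<alpha>) \<le>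
    F x (t * s) * (t powr (- \<alpha>) * s powr (- \<alpha>)) * (t powr \<alpha> * s powr \<alpha>)"
    using assms by (intro mult_right_mono) (auto simp: powr_mult)
  then show ?thesis using assms by (simp add: powr_minus field_simps)
qed

lemma f_mult_le_near_0:
  assumes "r < \<delta>" "\<tau> \<ge> 0"
  shows "f x r * r \<le> \<tau> * \<bar>r\<bar> powr p"
proof (cases "r > 0")
  case True
  have "f x r * r \<le> \<tau> * r powr (p - 1) * r"
    using True assms psi_small[of r x] by (intro mult_right_mono) (auto simp: f_def)
  then show ?thesis using True by (simp add: powr_diff)
qed (use assms in auto)

text \<open>Positivity of the nonlinearity makes \<open>\<tau>\<close>, and with it \<open>lambda_p\<close>, positive.\<close>
lemma tau_pos: "\<tau> > 0"
proof -
  fix x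
  have "0 < f x (\<delta> / 2)" using delta_pos by (intro f_pos) auto
  also have "\<dots> \<le> \<tau> * (\<delta> / 2) powr (p - 1)"
    using psi_small[of "\<delta>/2" x] delta_pos by (simp add: f_def)
  finally show ?thesis using delta_pos by (simp add: zero_less_mult_iff)
qed

abbreviation "Lam \<equiv> lambda_p E w \<sigma> p \<rho>"

lemma lambda_pos: "Lam > 0" using tau_pos tau_less by simp

lemma powr_le_energy:
  assumes "finite_energy u"
  shows "\<bar>u x\<bar> powr p \<le> energy u / (Lam * \<sigma>\<^sub>0)"
proof -
  have "Lam * (\<sigma>\<^sub>0 * \<bar>u x\<bar> powr p) \<le> Lam * (\<sigma> x * \<bar>u x\<bar> powr p)"
    using lambda_pos sigma_ge by (intro mult_left_mono mult_right_mono) auto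
  also have "\<dots> \<le> Lam * (\<Sum>\<^sub>\<infinity>x. \<sigma> x * \<bar>u x\<bar> powr p)"
    using sum_le_infsum[OF summable_Lp[OF assms], of "{x}"] lambda_pos by (intro mult_left_mono) auto
  also have "\<dots> \<le> energy u" by (rule Lp_powr_le[OF assms])
  finally show ?thesis using lambda_pos sigma0_pos by (simp add: field_simps)
qed

lemma energy_pos:
  assumes "finite_energy u" "u x \<noteq> 0" shows "energy u > 0"
proof -
  have "0 < \<bar>u x\<bar> powr p" using assms by simp
  also have "\<dots> \<le> energy u / (Lam * \<sigma>\<^sub>0)" using powr_le_energy[OF assms(1)] .
  finally show ?thesis
    using mult_pos_pos[OF lambda_pos sigma0_pos] by (auto simp: zero_less_divide_iff)
qed

definition f_term :: "('v \<Rightarrow> real) \<Rightarrow> 'v \<Rightarrow> real" where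
  "f_term u x = \<sigma> x * (f x (u x) * u x)"

definition F_term :: "('v \<Rightarrow> real) \<Rightarrow> 'v \<Rightarrow> real" where
  "F_term u x = \<sigma> x * F x (u x)"

definition f_integral :: "('v \<Rightarrow> real) \<Rightarrow> real" where
  "f_integral u = (\<Sum>\<^sub>\<infinity>x. f_term u x)"

definition F_integral :: "('v \<Rightarrow> real) \<Rightarrow> real" where
  "F_integral u = (\<Sum>\<^sub>\<infinity>x. F_term u x)"

lemma f_term_nonneg [simp]: "0 \<le> f_term u x" by (simp add: f_term_def)

lemma F_term_nonneg [simp]: "0 \<le> F_term u x" by (simp add: F_term_def)

lemma F_term_le: "F_term u x \<le> f_term u x"
  by (simp add: f_term_def F_term_def F_le mult_left_mono)

lemma f_term_le_near_0: "u x < \<delta> \<Longrightarrow> f_term u x \<le> \<tau> * (\<sigma> x * \<bar>u x\<bar> powr p)"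
  using mult_left_mono[OF f_mult_le_near_0[of "u x" x], of "\<sigma> x"] tau_pos
  by (simp add: f_term_def mult.left_commute)

lemma summable_f_term:
  assumes "finite_energy u"
  shows "f_term u summable_on UNIV"
proof -
  let ?S = "{x. \<bar>u x\<bar> \<ge> \<delta>}"
  have S: "finite ?S" by (rule finite_superlevel[OF assms delta_pos])
  have "f_term u summable_on - ?S"
  proof (rule summable_on_comparison_test)
    show "(\<lambda>x. \<tau> * (\<sigma> x * \<bar>u x\<bar> powr p)) summable_on - ?S"
      using summable_Lp[OF assms] by (intro summable_on_cmult_right) (auto intro: summable_on_subset)
    show "f_term u x \<le> \<tau> * (\<sigma> x * \<bar>u x\<bar> powr p)" if "x \<in> - ?S" for x
      using that by (intro f_term_le_near_0) auto
  qed auto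
  then have "f_term u summable_on ?S \<union> - ?S"
    using S by (intro summable_on_Un_disjoint) auto
  then show ?thesis by simp
qed

lemma summable_F_term:
  assumes "finite_energy u"
  shows "F_term u summable_on UNIV"
  by (rule summable_on_comparison_test[OF summable_f_term[OF assms]]) (auto simp: F_term_le)

lemma alpha_F_integral_le:
  assumes "finite_energy u"
  shows "\<alpha> * F_integral u \<le> f_integral u"
proof -
  have "\<alpha> * F_integral u = (\<Sum>\<^sub>\<infinity>x. \<alpha> * F_term u x)" by (simp add: F_integral_def infsum_cmult_right')
  also have "\<dots> \<le> f_integral u" unfolding f_integral_def
  proof (rule infsum_mono)
    show "\<alpha> * F_term u x \<le> f_term u x" for x
      using mult_left_mono[OF alpha_F_le[of x "u x"], of "\<sigma> x"]
      by (simp add: F_term_def f_term_def mult.left_commute)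
  qed (use summable_F_term[OF assms] summable_f_term[OF assms] in \<open>auto intro: summable_on_cmult_right\<close>)
  finally show ?thesis .
qed

lemma f_integral_le_small:
  assumes u: "finite_energy u" and small: "\<And>x. u x < \<delta>"
  shows "f_integral u \<le> \<tau> / Lam * energy u"
proof -
  have "f_integral u \<le> (\<Sum>\<^sub>\<infinity>x. \<tau> * (\<sigma> x * \<bar>u x\<bar> powr p))"
    unfolding f_integral_def
    using summable_Lp[OF u] summable_f_term[OF u] small
    by (intro infsum_mono summable_on_cmult_right f_term_le_near_0) auto
  also have "\<dots> = \<tau> / Lam * (Lam * (\<Sum>\<^sub>\<infinity>x. \<sigma> x * \<bar>u x\<bar> powr p))"
    using lambda_pos by (simp add: infsum_cmult_right')
  also have "\<dots> \<le> \<tau> / Lam * energy u"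
    using Lp_powr_le[OF u] tau_pos lambda_pos by (intro mult_left_mono) auto
  finally show ?thesis .
qed

lemma f_integral_less_small:
  assumes "finite_energy u" "\<And>x. u x < \<delta>" "energy u > 0"
  shows "f_integral u < energy u"
proof -
  have "\<tau> / Lam * energy u < 1 * energy u"
    using assms(3) tau_less lambda_pos by (intro mult_strict_right_mono) auto
  with f_integral_le_small[OF assms(1,2)] show ?thesis by simp
qed

abbreviation "J \<equiv> J_fun E w \<sigma> p \<rho> \<psi>"
abbreviation "\<N> \<equiv> Nehari E w \<sigma> p \<rho> \<psi>"

lemma J_eq: "J u = energy u / p - F_integral u"
  by (simp add: J_fun_def Hp_norm_powr F_integral_def F_term_def F_def[abs_def] integral_V_def pos_part_def[abs_def])

lemma J_deriv_self:
  assumes "finite_energy u"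
  shows "J_deriv E w \<sigma> p \<rho> \<psi> u u = energy u - f_integral u"
proof -
  have pw: "r powr (p - 2) * (r * r) = r powr p" if "r \<ge> 0" for r :: real
    using that by (cases "r = 0") (auto simp: powr_diff power2_eq_square p_pos)
  have "gn u x powr (p - 2) * grad_inner E w \<sigma> u u x = gn u x powr p" for x
    using pw[of "gn u x"] gn_squared[of u x] by (simp add: power2_eq_square)
  moreover have "\<bar>u x\<bar> powr (p - 2) * (u x * u x) = \<bar>u x\<bar> powr p" for x
    using pw[of "\<bar>u x\<bar>"] by (simp add: abs_mult_self_eq)
  ultimately have "J_deriv E w \<sigma> p \<rho> \<psi> u u = (\<Sum>\<^sub>\<infinity>x. energy_term u x + - f_term u x)"
    by (simp add: J_deriv_def integral_V_def energy_term_def f_term_def f_def pos_part_def mult.assoc algebra_simps)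
  also have "\<dots> = energy u - f_integral u"
    using assms summable_f_term[OF assms]
    by (subst infsum_add) (auto simp: finite_energy_def energy_def f_integral_def infsum_uminus summable_on_uminus)
  finally show ?thesis .
qed

lemma Nehari_iff:
  "u \<in> \<N> \<longleftrightarrow> finite_energy u \<and> u \<noteq> (\<lambda>x. 0) \<and> energy u = f_integral u"
  by (auto simp: Nehari_def Hp_eq_finite_energy J_deriv_self)

text \<open>A function that stays below \<open>\<delta>\<close> has a nonlinear term smaller than its energy.  This keeps
  the manifold away from \<open>0\<close> in a way that survives pointwise limits.\<close>
lemma Nehari_peak:
  assumes "u \<in> \<N>"
  obtains x where "u x \<ge> \<delta>"
proof -
  have u: "finite_energy u" "u \<noteq> (\<lambda>x. 0)" "energy u = f_integral u" using assms by (auto simp: Nehari_iff)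
  then obtain y where "u y \<noteq> 0" by auto
  then have "energy u > 0" by (rule energy_pos[OF u(1)])
  with f_integral_less_small[OF u(1)] u(3) that show thesis by (metis less_irrefl not_less)
qed

text \<open>On the manifold the energy equals \<open>\<integral>\<psi>(x,u\<^sup>+)u d\<sigma> \<ge> \<alpha>\<integral>\<Psi>(x,u\<^sup>+)d\<sigma>\<close>; as \<open>\<alpha> > p\<close>, sublevel sets of
  \<open>J\<close> in the manifold have bounded energy.\<close>
lemma Nehari_J_ge:
  assumes "u \<in> \<N>"
  shows "(1 / p - 1 / \<alpha>) * energy u \<le> J u"
proof -
  have u: "finite_energy u" "energy u = f_integral u" using assms by (auto simp: Nehari_iff)
  have "F_integral u \<le> energy u / \<alpha>"
    using alpha_F_integral_le[OF u(1)] u(2) alpha_gt_1 by (simp add: field_simps)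
  then show ?thesis by (simp add: J_eq algebra_simps)
qed

lemma coercivity_pos: "1 / p - 1 / \<alpha> > 0"
  using alpha_gt p_pos by (simp add: field_simps)

section \<open>The functional along rays\<close>

text \<open>Formally, \<open>t \<mapsto> J(tz)\<close> has derivative \<open>t\<^bsup>p-1\<^esup>(energy z - q z t)\<close>.\<close>
definition q :: "('v \<Rightarrow> real) \<Rightarrow> real \<Rightarrow> real" where
  "q z t = f_integral (\<lambda>x. t * z x) / t powr p"

definition q_term :: "('v \<Rightarrow> real) \<Rightarrow> real \<Rightarrow> 'v \<Rightarrow> real" where
  "q_term z t x = f_term (\<lambda>x. t * z x) x / t powr p"

lemma q_eq: "q z t = infsum (q_term z t) UNIV"
proof -
  have "infsum (q_term z t) UNIV = (\<Sum>\<^sub>\<infinity>x. (1 / t powr p) * f_term (\<lambda>x. t * z x) x)"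
    by (rule infsum_cong) (simp add: q_term_def)
  then show ?thesis unfolding infsum_cmult_right' by (simp add: q_def f_integral_def)
qed

lemma q_term_nonneg [simp]: "0 \<le> q_term z t x" by (simp add: q_term_def)

lemma summable_q_term:
  assumes "finite_energy z" "t > 0"
  shows "q_term z t summable_on UNIV"
proof -
  have "(\<lambda>x. (1 / t powr p) * f_term (\<lambda>x. t * z x) x) summable_on UNIV"
    using assms by (intro summable_on_cmult_right summable_f_term finite_energy_scale) auto
  then show ?thesis by (rule summable_on_cong[THEN iffD1, rotated]) (simp add: q_term_def)
qed

text \<open>In this form the dependence on \<open>t\<close> is through the strictly increasing quotient of the
  nonlinearity alone.\<close>
lemma q_term_pos_eq:
  assumes "t > 0" "z x > 0"
  shows "q_term z t x = \<sigma> x * z x powr p * (f x (t * z x) / (t * z x) powr (p - 1))"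
proof -
  have "(t * z x) powr (p - 1) * t * z x = t powr p * z x powr p"
    using assms by (simp add: powr_diff powr_mult)
  then have "z x powr p / (t * z x) powr (p - 1) = t * z x / t powr p"
    using assms by (simp add: field_simps)
  from arg_cong[OF this, of "\<lambda>c. \<sigma> x * f x (t * z x) * c"] show ?thesis
    by (simp add: q_term_def f_term_def mult_ac)
qed

lemma q_term_0: "t > 0 \<Longrightarrow> z x \<le> 0 \<Longrightarrow> q_term z t x = 0"
  by (simp add: q_term_def f_term_def mult_nonneg_nonpos)

lemma q_term_less:
  assumes "0 < a" "a < b" "z x > 0"
  shows "q_term z a x < q_term z b x"
proof -
  have "\<sigma> x * z x powr p * (f x (a * z x) / (a * z x) powr (p - 1))
      < \<sigma> x * z x powr p * (f x (b * z x) / (b * z x) powr (p - 1))"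
    using assms sigma_pos[of x] by (intro mult_strict_left_mono f_quotient_less) auto
  then show ?thesis using assms by (simp only: q_term_pos_eq)
qed

lemma q_term_mono: "0 < a \<Longrightarrow> a \<le> b \<Longrightarrow> q_term z a x \<le> q_term z b x"
  using q_term_less[of a b z x] q_term_0[of _ z x] by (cases "a = b"; cases "z x > 0") auto

lemma q_mono:
  assumes "finite_energy z" "0 < a" "a \<le> b" shows "q z a \<le> q z b"
  unfolding q_eq using assms by (intro infsum_mono summable_q_term q_term_mono) auto

lemma q_less:
  assumes z: "finite_energy z" "z x > 0" and ab: "0 < a" "a < b"
  shows "q z a < q z b"
proof -
  have s: "q_term z t summable_on UNIV" if "t > 0" for t using summable_q_term[OF z(1) that] .
  have "infsum (q_term z a) (- {x}) \<le> infsum (q_term z b) (- {x})"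
    using ab s by (intro infsum_mono q_term_mono summable_on_subset[OF s, of _ "- {x}"]) auto
  moreover have "q_term z a x < q_term z b x" using q_term_less[where z = z, OF ab z(2)] .
  ultimately show ?thesis
    using infsum_split[OF s, of a "{x}"] infsum_split[OF s, of b "{x}"] ab by (simp add: q_eq)
qed

lemma F_term_ray_bounds:
  assumes "0 < a" "a \<le> b"
  shows "q_term z a x * ((b powr p - a powr p) / p) \<le> F_term (\<lambda>x. b * z x) x - F_term (\<lambda>x. a * z x) x"
    and "F_term (\<lambda>x. b * z x) x - F_term (\<lambda>x. a * z x) x \<le> q_term z b x * ((b powr p - a powr p) / p)"
proof -
  have "q_term z a x * ((b powr p - a powr p) / p) \<le> F_term (\<lambda>x. b * z x) x - F_term (\<lambda>x. a * z x) x \<and>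
    F_term (\<lambda>x. b * z x) x - F_term (\<lambda>x. a * z x) x \<le> q_term z b x * ((b powr p - a powr p) / p)"
  proof (cases "z x > 0")
    case True
    have *: "\<sigma> x * z x powr p * c * ((b powr p - a powr p) / p)
        = \<sigma> x * (c * (((b * z x) powr p - (a * z x) powr p) / p))" for c
      using assms True by (simp add: powr_mult algebra_simps)
    have inc: "0 < a * z x" "a * z x \<le> b * z x" using assms True by auto
    have q: "q_term z t x * ((b powr p - a powr p) / p)
        = \<sigma> x * (f x (t * z x) / (t * z x) powr (p - 1) * (((b * z x) powr p - (a * z x) powr p) / p))"
      if "t > 0" for t using that True by (simp only: q_term_pos_eq *)
    show ?thesis
      using assms F_increment_bounds[OF inc, of x, THEN mult_left_mono[OF _ sigma_nonneg[of x]]]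
      by (simp only: q F_term_def right_diff_distrib[of "\<sigma> x", symmetric] less_le_trans)
  next
    case False
    then show ?thesis using assms by (simp add: q_term_0 F_term_def mult_nonneg_nonpos)
  qed
  then show "q_term z a x * ((b powr p - a powr p) / p) \<le> F_term (\<lambda>x. b * z x) x - F_term (\<lambda>x. a * z x) x"
    and "F_term (\<lambda>x. b * z x) x - F_term (\<lambda>x. a * z x) x \<le> q_term z b x * ((b powr p - a powr p) / p)"
    by blast+
qed

text \<open>The formal derivative of \<open>J\<close> along a ray, in integrated form with the monotone factor estimated at an
  end point.  It follows by summing pointwise bounds, without differentiating under the infinite sum.\<close>
lemma J_ray_bounds:
  assumes z: "finite_energy z" and ab: "0 < a" "a \<le> b"
  shows "(b powr p - a powr p) / p * (energy z - q z b) \<le> J (\<lambda>x. b * z x) - J (\<lambda>x. a * z x)"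
    and "J (\<lambda>x. b * z x) - J (\<lambda>x. a * z x) \<le> (b powr p - a powr p) / p * (energy z - q z a)"
proof -
  define c where "c = (b powr p - a powr p) / p"
  have sF: "F_term (\<lambda>x. t * z x) summable_on UNIV" if "t > 0" for t
    using z that by (intro summable_F_term finite_energy_scale) auto
  have sq: "(\<lambda>x. q_term z t x * c) summable_on UNIV" if "t > 0" for t
    using summable_q_term[OF z that] by (rule summable_on_cmult_left)
  have "F_integral (\<lambda>x. a * z x) + q z a * c = (\<Sum>\<^sub>\<infinity>x. F_term (\<lambda>x. a * z x) x + q_term z a x * c)"
    using sF sq ab by (subst infsum_add) (auto simp: F_integral_def q_eq infsum_cmult_left')
  also have "\<dots> \<le> F_integral (\<lambda>x. b * z x)"
    unfolding F_integral_def using sF sq ab F_term_ray_bounds(1)[OF ab, of z, folded c_def]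
    by (intro infsum_mono summable_on_add) (auto simp: algebra_simps)
  finally have 1: "F_integral (\<lambda>x. a * z x) + q z a * c \<le> F_integral (\<lambda>x. b * z x)" .
  have "F_integral (\<lambda>x. b * z x) \<le> (\<Sum>\<^sub>\<infinity>x. F_term (\<lambda>x. a * z x) x + q_term z b x * c)"
    unfolding F_integral_def using sF sq ab F_term_ray_bounds(2)[OF ab, of z, folded c_def]
    by (intro infsum_mono summable_on_add) (auto simp: algebra_simps)
  also have "\<dots> = F_integral (\<lambda>x. a * z x) + q z b * c"
    using sF sq ab by (subst infsum_add) (auto simp: F_integral_def q_eq infsum_cmult_left')
  finally have 2: "F_integral (\<lambda>x. b * z x) \<le> F_integral (\<lambda>x. a * z x) + q z b * c" .
  have J: "J (\<lambda>x. t * z x) = t powr p * energy z / p - F_integral (\<lambda>x. t * z x)" if "t > 0" for t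
    using that by (simp add: J_eq energy_scale)
  have e: "c * energy z = b powr p * energy z / p - a powr p * energy z / p"
    unfolding c_def by (simp add: left_diff_distrib diff_divide_distrib)
  show "(b powr p - a powr p) / p * (energy z - q z b) \<le> J (\<lambda>x. b * z x) - J (\<lambda>x. a * z x)"
    using 2 e J[of a] J[of b] ab unfolding c_def[symmetric] right_diff_distrib mult.commute[of c "q z b"] by linarith
  show "J (\<lambda>x. b * z x) - J (\<lambda>x. a * z x) \<le> (b powr p - a powr p) / p * (energy z - q z a)"
    using 1 e J[of a] J[of b] ab unfolding c_def[symmetric] right_diff_distrib mult.commute[of c "q z a"] by linarith
qed

lemma powr_gap_nonneg: "0 < a \<Longrightarrow> a \<le> b \<Longrightarrow> 0 \<le> (b powr p - a powr p) / p"
  using p_pos by (simp add: powr_mono2)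

lemma J_increasing_before:
  assumes "finite_energy z" "0 < a" "a \<le> b" "q z b \<le> energy z"
  shows "J (\<lambda>x. a * z x) \<le> J (\<lambda>x. b * z x)"
  using J_ray_bounds(1)[OF assms(1-3)] mult_nonneg_nonneg[OF powr_gap_nonneg[OF assms(2,3)], of "energy z - q z b"]
    assms(4) by linarith

lemma J_decreasing_after:
  assumes "finite_energy z" "0 < a" "a \<le> b" "energy z \<le> q z a"
  shows "J (\<lambda>x. b * z x) \<le> J (\<lambda>x. a * z x)"
  using J_ray_bounds(2)[OF assms(1-3)] mult_nonneg_nonpos[OF powr_gap_nonneg[OF assms(2,3)], of "energy z - q z a"]
    assms(4) by linarith

lemma Nehari_ray_iff:
  assumes "finite_energy z" "t > 0" "z x > 0"
  shows "(\<lambda>x. t * z x) \<in> \<N> \<longleftrightarrow> q z t = energy z"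
proof -
  have "(\<lambda>x. t * z x) \<noteq> (\<lambda>x. 0)" using assms by (metis less_irrefl mult_pos_pos)
  then show ?thesis using assms finite_energy_scale[of t z]
    by (auto simp: Nehari_iff energy_scale q_def field_simps)
qed

lemma J_ray_max:
  assumes "finite_energy z" "t > 0" "q z t = energy z" "r > 0"
  shows "J (\<lambda>x. r * z x) \<le> J (\<lambda>x. t * z x)"
  using J_increasing_before[of z r t] J_decreasing_after[of z t r] assms by (cases "r \<le> t") auto

lemma J_ray_strict_max:
  assumes z: "finite_energy z" "z x > 0" and t: "t > 0" "q z t = energy z" and r: "r > 0" "r \<noteq> t"
  shows "J (\<lambda>x. r * z x) < J (\<lambda>x. t * z x)"
proof -
  let ?m = "(r + t) / 2"
  have m: "?m > 0" using t r by simp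
  have "J (\<lambda>x. ?m * z x) \<le> J (\<lambda>x. t * z x)" using J_ray_max[OF z(1) t m] .
  moreover have "J (\<lambda>x. r * z x) < J (\<lambda>x. ?m * z x)"
  proof (cases "r < t")
    case True
    have "0 < (?m powr p - r powr p) / p * (energy z - q z ?m)"
      using q_less[OF z m, of t] True t r p_pos by (intro mult_pos_pos divide_pos_pos) (auto intro!: powr_less_mono2)
    with J_ray_bounds(1)[OF z(1) r(1), of ?m] True show ?thesis by simp
  next
    case False
    have "(r powr p - ?m powr p) / p * (energy z - q z ?m) < 0"
      using q_less[OF z t(1), of ?m] False t r p_pos
      by (intro mult_pos_neg divide_pos_pos) (auto intro!: powr_less_mono2)
    with J_ray_bounds(2)[OF z(1) m, of r] False r(2) show ?thesis by simp
  qed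
  ultimately show ?thesis by simp
qed

text \<open>By monotonicity the terms for parameters up to \<open>2t\<close> are dominated by those at \<open>2t\<close>.\<close>
lemma isCont_q:
  assumes z: "finite_energy z" and t: "t > 0"
  shows "isCont (q z) t"
  unfolding isCont_def q_eq
proof (rule infsum_tendsto_dominated)
  show "q_term z (2 * t) summable_on UNIV" using summable_q_term[OF z] t by simp
  have "\<forall>\<^sub>F s in at t. s \<in> {0<..<2 * t}"
    using eventually_at_in_open'[of "{0<..<2 * t}" t] t by auto
  then show "\<forall>\<^sub>F s in at t. \<forall>x. 0 \<le> q_term z s x \<and> q_term z s x \<le> q_term z (2 * t) x"
    by eventually_elim (auto intro!: q_term_mono)
  have c: "((\<lambda>s. f x (s * z x)) \<longlongrightarrow> f x (t * z x)) (at t)" for x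
    by (rule isCont_tendsto_compose[OF isCont_f]) (intro tendsto_intros)
  show "((\<lambda>s. q_term z s x) \<longlongrightarrow> q_term z t x) (at t)" for x
    unfolding q_term_def f_term_def using t by (intro tendsto_intros c) auto
qed auto

lemma q_small:
  assumes z: "finite_energy z" "z x > 0"
  obtains t where "t > 0" "q z t < energy z"
proof
  have e: "energy z > 0" using energy_pos[OF z(1), of x] z(2) by simp
  \<comment> \<open>chosen so that \<open>|t z|\<^sup>p \<le> \<delta>\<^sup>p / 2\<close> everywhere\<close>
  define t where "t = (Lam * \<sigma>\<^sub>0 * \<delta> powr p / (2 * energy z)) powr (1 / p)"
  show t: "t > 0" using e lambda_pos sigma0_pos delta_pos by (simp add: t_def)
  have tp: "t powr p = Lam * \<sigma>\<^sub>0 * \<delta> powr p / (2 * energy z)"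
    using e lambda_pos sigma0_pos p_pos by (simp add: t_def powr_powr)
  have fin: "finite_energy (\<lambda>x. t * z x)" using z t by (intro finite_energy_scale) auto
  have "t * z y < \<delta>" for y
  proof -
    have "\<bar>t * z y\<bar> powr p \<le> t powr p * energy z / (Lam * \<sigma>\<^sub>0)"
      using powr_le_energy[OF fin, of y] t by (simp add: energy_scale)
    also have "\<dots> = \<delta> powr p / 2" using tp e lambda_pos sigma0_pos by (simp add: field_simps)
    also have "\<dots> < \<delta> powr p" using delta_pos by simp
    finally have "\<bar>t * z y\<bar> < \<delta>"
      using delta_pos p_pos by (metis abs_ge_zero less_eq_real_def not_less powr_mono2)
    then show ?thesis by simp
  qed
  moreover have "energy (\<lambda>x. t * z x) > 0" using energy_pos[OF fin, of x] z t by simp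
  ultimately have "f_integral (\<lambda>x. t * z x) < t powr p * energy z"
    using f_integral_less_small[OF fin] t by (simp add: energy_scale)
  then show "q z t < energy z" using t by (simp add: q_def field_simps)
qed

text \<open>A single vertex with \<open>z(x) > 0\<close> suffices: its term grows at least like \<open>t\<^bsup>\<alpha>-p\<^esup>\<close>.\<close>
lemma q_large:
  assumes z: "finite_energy z" "z x > 0"
  obtains t where "t > 0" "q z t \<ge> energy z"
proof
  define C where "C = \<sigma> x * \<alpha> * F x (z x)"
  have C: "C > 0" using sigma_pos alpha_gt_1 F_pos z(2) by (simp add: C_def)
  define t where "t = max 1 ((energy z / C) powr (1 / (\<alpha> - p)))"
  have t1: "t \<ge> 1" by (simp add: t_def)
  then show t: "t > 0" by simp
  have "energy z / C = ((energy z / C) powr (1 / (\<alpha> - p))) powr (\<alpha> - p)"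
    using alpha_gt C by (simp add: powr_powr)
  also have "\<dots> \<le> t powr (\<alpha> - p)" using alpha_gt by (intro powr_mono2) (auto simp: t_def)
  finally have "energy z \<le> C * t powr (\<alpha> - p)" using C by (simp add: field_simps)
  also have "\<dots> = \<sigma> x * (\<alpha> * (t powr \<alpha> * F x (z x))) / t powr p"
    by (simp add: C_def powr_diff)
  also have "\<dots> \<le> \<sigma> x * (\<alpha> * F x (t * z x)) / t powr p"
    using F_growth[OF z(2) t1, of x] alpha_gt_1 by (intro divide_right_mono mult_left_mono) auto
  also have "\<dots> \<le> q_term z t x"
    using alpha_F_le[of x "t * z x"] unfolding q_term_def f_term_def
    by (intro divide_right_mono mult_left_mono) auto
  also have "\<dots> \<le> q z t"
    using sum_le_infsum[OF summable_q_term[OF z(1) t], of "{x}"] by (simp add: q_eq)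
  finally show "energy z \<le> q z t" .
qed

lemma Nehari_ray_exists:
  assumes z: "finite_energy z" "z x > 0"
  obtains t where "t > 0" "q z t = energy z"
proof -
  obtain a where a: "a > 0" "q z a < energy z" using q_small[OF z] .
  obtain b where b: "b > 0" "q z b \<ge> energy z" using q_large[OF z] .
  have ab: "a \<le> b"
  proof (rule ccontr)
    assume "\<not> a \<le> b"
    with q_mono[OF z(1) b(1), of a] a b show False by simp
  qed
  have "\<exists>t\<ge>a. t \<le> b \<and> q z t = energy z"
    using a b ab by (intro IVT) (auto intro: isCont_q[OF z(1)])
  then show thesis using a(1) that by (metis less_le_trans)
qed

section \<open>A minimizer on the Nehari manifold\<close>

text \<open>For large \<open>R\<close>, where \<open>\<rho> \<ge> R\<close> all \<open>g\<^sub>n\<close> lie below \<open>\<delta>\<close>, and there the terms are at most \<open>\<tau>\<sigma>|g\<^sub>n|\<^sup>p\<close>, whose sum is at most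
  \<open>\<tau>K/R\<close>.\<close>
lemma F_integral_tendsto:
  assumes lim: "\<And>x. (\<lambda>n. g n x) \<longlonglongrightarrow> u x"
    and g: "\<And>n. finite_energy (g n)" "\<And>n. energy (g n) \<le> K"
  shows "(\<lambda>n. F_integral (g n)) \<longlonglongrightarrow> F_integral u"
  unfolding F_integral_def
proof (rule infsum_tendsto_uniform_tails(2))
  show "(\<lambda>n. F_term (g n) x) \<longlonglongrightarrow> F_term u x" for x
    unfolding F_term_def by (intro tendsto_intros isCont_tendsto_compose[OF isCont_F] lim)
  show "\<forall>\<^sub>F n in sequentially. (\<forall>x. 0 \<le> F_term (g n) x) \<and> F_term (g n) summable_on UNIV"
    using summable_F_term[OF g(1)] by simp
  have K: "0 \<le> K" using g(2)[of 0] energy_nonneg[of "g 0"] by linarith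
  fix e :: real assume e: "e > 0"
  obtain R\<^sub>0 where R\<^sub>0: "R\<^sub>0 > 0"
      "\<And>u x. finite_energy u \<Longrightarrow> energy u \<le> K \<Longrightarrow> \<rho> x \<ge> R\<^sub>0 \<Longrightarrow> \<bar>u x\<bar> < \<delta>"
    using uniformly_small_at_infinity[OF delta_pos K] by blast
  define R where "R = max R\<^sub>0 (\<tau> * K / e)"
  have R: "R > 0" "R \<ge> R\<^sub>0" using R\<^sub>0(1) by (auto simp: R_def)
  have "\<tau> * K / e \<le> R" by (simp add: R_def)
  then have tail: "\<tau> * (K / R) \<le> e" using e R by (simp add: field_simps)
  let ?A = "- {x. \<rho> x < R}"
  have "infsum (F_term (g n)) ?A \<le> e" for n
  proof -
    have "infsum (F_term (g n)) ?A \<le> (\<Sum>\<^sub>\<infinity>x\<in>?A. \<tau> * (\<sigma> x * \<bar>g n x\<bar> powr p))"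
    proof (rule infsum_mono)
      show "F_term (g n) summable_on ?A" using summable_F_term[OF g(1)] by (rule summable_on_subset) simp
      show "(\<lambda>x. \<tau> * (\<sigma> x * \<bar>g n x\<bar> powr p)) summable_on ?A"
        using summable_Lp[OF g(1)] by (intro summable_on_cmult_right) (auto intro: summable_on_subset)
      fix x assume "x \<in> ?A"
      then have "\<bar>g n x\<bar> < \<delta>" using R(2) g by (intro R\<^sub>0(2)) auto
      then have "f_term (g n) x \<le> \<tau> * (\<sigma> x * \<bar>g n x\<bar> powr p)" by (intro f_term_le_near_0) auto
      with F_term_le[of "g n" x] show "F_term (g n) x \<le> \<tau> * (\<sigma> x * \<bar>g n x\<bar> powr p)" by linarith
    qed
    also have "\<dots> = \<tau> * (\<Sum>\<^sub>\<infinity>x\<in>?A. \<sigma> x * \<bar>g n x\<bar> powr p)" by (rule infsum_cmult_right')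
    also have "\<dots> \<le> \<tau> * (K / R)"
      using tail_Lp_le[OF g(1) R(1), of n] divide_right_mono[OF g(2)[of n], of R] R(1) tau_pos
      by (intro mult_left_mono) auto
    also note tail
    finally show ?thesis .
  qed
  then show "\<exists>S. finite S \<and> (\<forall>\<^sub>F n in sequentially. infsum (F_term (g n)) (- S) \<le> e)"
    using finite_sublevel by (intro exI[of _ "{x. \<rho> x < R}"]) auto
qed simp

text \<open>Bounded energy bounds all values uniformly, and there are only countably many vertices, so a
  diagonal argument applies.\<close>
lemma bounded_energy_subsequence:
  assumes "\<And>n. finite_energy (U n)" "\<And>n. energy (U n) \<le> K"
  shows "\<exists>k u. strict_mono (k :: nat \<Rightarrow> nat) \<and> (\<forall>x. (\<lambda>n. U (k n) x) \<longlonglongrightarrow> u x)"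
proof -
  have K: "0 \<le> K" using assms(2)[of 0] energy_nonneg[of "U 0"] by linarith
  define M where "M = (K / (Lam * \<sigma>\<^sub>0)) powr (1 / p)"
  have "norm (U n x) \<le> M" for n x
  proof -
    have "\<bar>U n x\<bar> powr p \<le> K / (Lam * \<sigma>\<^sub>0)"
      using powr_le_energy[OF assms(1), of n x] divide_right_mono[OF assms(2)[of n], of "Lam * \<sigma>\<^sub>0"]
        lambda_pos sigma0_pos by (auto intro: order_trans)
    then have "(\<bar>U n x\<bar> powr p) powr (1 / p) \<le> M"
      unfolding M_def using p_pos by (intro powr_mono2) auto
    then show ?thesis using p_pos by (simp add: powr_powr)
  qed
  from function_convergent_subsequence[OF countable_UNIV, of U, OF this]
  obtain k where k: "strict_mono (k :: nat \<Rightarrow> nat)" "\<And>x. \<exists>l. (\<lambda>n. U (k n) x) \<longlonglongrightarrow> l" by auto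
  obtain u where "\<And>x. (\<lambda>n. U (k n) x) \<longlonglongrightarrow> u x" using k(2) by metis
  with k(1) show ?thesis by blast
qed

lemma Nehari_nonempty: "\<N> \<noteq> {}"
proof -
  fix x\<^sub>0 :: 'v
  let ?z = "\<lambda>x. if x = x\<^sub>0 then 1 else 0 :: real"
  have z: "finite_energy ?z" by (rule C_c_finite_energy) (simp add: C_c_def)
  obtain t where t: "t > 0" "q ?z t = energy ?z" using Nehari_ray_exists[OF z, of x\<^sub>0] by auto
  then have "(\<lambda>x. t * ?z x) \<in> \<N>" using Nehari_ray_iff[OF z t(1), of x\<^sub>0] by auto
  then show ?thesis by blast
qed

lemma J_nonneg: "u \<in> \<N> \<Longrightarrow> 0 \<le> J u"
  using Nehari_J_ge[of u] mult_nonneg_nonneg[OF less_imp_le[OF coercivity_pos] energy_nonneg[of u]]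
  by linarith

lemma bdd_below_J: "bdd_below (J ` \<N>)"
  by (rule bdd_belowI2[of _ 0]) (rule J_nonneg)

lemma J_Nehari_ray_le:
  assumes "u \<in> \<N>" "r > 0"
  shows "J (\<lambda>x. r * u x) \<le> J u"
proof -
  have "finite_energy u" "q u 1 = energy u" using assms by (auto simp: Nehari_iff q_def)
  from J_ray_max[OF this(1) _ this(2) assms(2)] show ?thesis by simp
qed

text \<open>The limit \<open>u\<close> of a minimizing sequence need not lie on the manifold, but some \<open>tu\<close> does, and for
  the same \<open>t\<close> each \<open>J(tu\<^sub>n)\<close> is at most \<open>J(u\<^sub>n)\<close>.  The passage to the limit is made for
  finite partial sums of the energy, which converge even where the energies do not.\<close>
lemma Nehari_minimizer_exists:
  "\<exists>v\<in>\<N>. \<forall>u\<in>\<N>. J v \<le> J u"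
proof -
  define c where "c = (INF u\<in>\<N>. J u)"
  have "\<exists>u\<in>\<N>. J u < c + 1 / real (Suc n)" for n
  proof -
    have "c < c + 1 / real (Suc n)" by simp
    then show ?thesis
      unfolding c_def by (subst (asm) cINF_less_iff[OF Nehari_nonempty bdd_below_J])
  qed
  then have "\<forall>n. \<exists>u. u \<in> \<N> \<and> J u < c + 1 / real (Suc n)" by blast
  from choice[OF this] obtain U where U: "\<And>n. U n \<in> \<N>" "\<And>n. J (U n) < c + 1 / real (Suc n)" by blast
  define K where "K = (c + 1) / (1 / p - 1 / \<alpha>)"
  have Ufin: "finite_energy (U n)" for n using U by (auto simp: Nehari_iff)
  have UK: "energy (U n) \<le> K" for n
  proof -
    have "(1 / p - 1 / \<alpha>) * energy (U n) \<le> c + 1 / real (Suc n)"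
      using Nehari_J_ge[OF U(1)[of n]] U(2)[of n] by linarith
    also have "\<dots> \<le> c + 1" by simp
    finally show ?thesis using coercivity_pos by (simp add: K_def field_simps)
  qed
  have K: "0 \<le> K" using UK[of 0] energy_nonneg[of "U 0"] by linarith
  from bounded_energy_subsequence[of U K, OF Ufin UK]
  obtain k where "\<exists>u. strict_mono k \<and> (\<forall>x. (\<lambda>n. U (k n) x) \<longlonglongrightarrow> u x)" ..
  then obtain u where ku: "strict_mono k \<and> (\<forall>x. (\<lambda>n. U (k n) x) \<longlonglongrightarrow> u x)" ..
  then have k: "strict_mono k" and lim: "\<And>x. (\<lambda>n. U (k n) x) \<longlonglongrightarrow> u x" by simp_all
  have u: "finite_energy u" by (rule fatou_lim(1)[of "\<lambda>n. U (k n)", OF lim Ufin UK])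
  \<comment> \<open>all peaks lie in one finite sublevel set of \<open>\<rho>\<close>, so one of them persists in the limit\<close>
  have peak: "\<exists>x. u x \<ge> \<delta>"
  proof (rule ccontr)
    assume "\<nexists>x. u x \<ge> \<delta>"
    then have less: "u x < \<delta>" for x by (simp add: not_le)
    obtain R where R: "R > 0"
      "\<And>u x. finite_energy u \<Longrightarrow> energy u \<le> K \<Longrightarrow> \<rho> x \<ge> R \<Longrightarrow> \<bar>u x\<bar> < \<delta>"
      using uniformly_small_at_infinity[OF delta_pos K] by blast
    have ev: "\<forall>\<^sub>F n in sequentially. U (k n) x < \<delta>" for x
      by (rule order_tendstoD(2)[OF lim less])
    have "\<forall>\<^sub>F n in sequentially. \<forall>x\<in>{x. \<rho> x < R}. U (k n) x < \<delta>"
      by (rule eventually_ball_finite[OF finite_sublevel]) (simp add: ev)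
    from eventually_happens'[OF sequentially_bot this]
    obtain n where n: "\<forall>x\<in>{x. \<rho> x < R}. U (k n) x < \<delta>" ..
    obtain x where "U (k n) x \<ge> \<delta>" using Nehari_peak[OF U(1)[of "k n"]] .
    moreover have "U (k n) x < \<delta>"
    proof (cases "\<rho> x < R")
      case True
      then show ?thesis using n by simp
    next
      case False
      then have "\<bar>U (k n) x\<bar> < \<delta>" using R(2)[OF Ufin[of "k n"] UK[of "k n"], of x] by simp
      then show ?thesis by simp
    qed
    ultimately show False by simp
  qed
  then obtain x where "u x \<ge> \<delta>" ..
  then have x: "u x > 0" using delta_pos by linarith
  obtain t where t: "t > 0" "q u t = energy u" using Nehari_ray_exists[OF u x] .
  define v where "v = (\<lambda>x. t * u x)"
  have v: "v \<in> \<N>" using Nehari_ray_iff[OF u t(1) x] t(2) by (simp add: v_def)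
  have limF: "(\<lambda>n. F_integral (\<lambda>x. t * U (k n) x)) \<longlonglongrightarrow> F_integral v"
    unfolding v_def
  proof (rule F_integral_tendsto[where K = "t powr p * K"])
    show "(\<lambda>n. t * U (k n) x) \<longlonglongrightarrow> t * u x" for x by (intro tendsto_intros lim)
  qed (use t Ufin UK in \<open>auto intro: finite_energy_scale simp: energy_scale\<close>)
  have part: "t powr p / p * sum (energy_term u) S \<le> c + F_integral v" if S: "finite S" for S
  proof (rule LIMSEQ_le)
    show "(\<lambda>n. t powr p / p * sum (energy_term (U (k n))) S) \<longlonglongrightarrow> t powr p / p * sum (energy_term u) S"
      by (intro tendsto_intros energy_term_tendsto lim)
    have "(\<lambda>n. c + 1 / real (Suc n) + F_integral (\<lambda>x. t * U (k n) x)) \<longlonglongrightarrow> c + 0 + F_integral v"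
      by (intro tendsto_intros limF LIMSEQ_Suc[OF lim_1_over_n])
    then show "(\<lambda>n. c + 1 / real (Suc n) + F_integral (\<lambda>x. t * U (k n) x)) \<longlonglongrightarrow> c + F_integral v" by simp
    have "t powr p / p * sum (energy_term (U (k n))) S
        \<le> c + 1 / real (Suc n) + F_integral (\<lambda>x. t * U (k n) x)" for n
    proof -
      have "sum (energy_term (U (k n))) S \<le> energy (U (k n))"
        unfolding energy_def using Ufin S by (intro sum_le_infsum) (auto simp: finite_energy_def)
      then have "t powr p / p * sum (energy_term (U (k n))) S \<le> t powr p / p * energy (U (k n))"
        using p_pos by (intro mult_left_mono) auto
      also have "\<dots> = J (\<lambda>x. t * U (k n) x) + F_integral (\<lambda>x. t * U (k n) x)"
        using t(1) by (simp add: J_eq energy_scale)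
      also have "J (\<lambda>x. t * U (k n) x) \<le> J (U (k n))" by (rule J_Nehari_ray_le[OF U(1) t(1)])
      also have "J (U (k n)) \<le> c + 1 / real (Suc (k n))" using U(2)[of "k n"] by simp
      also have "\<dots> \<le> c + 1 / real (Suc n)"
        using seq_suble[OF k, of n] by (intro add_left_mono divide_left_mono) auto
      finally show ?thesis by simp
    qed
    then show "\<exists>N. \<forall>n\<ge>N. t powr p / p * sum (energy_term (U (k n))) S
        \<le> c + 1 / real (Suc n) + F_integral (\<lambda>x. t * U (k n) x)" by blast
  qed
  have tp: "t powr p / p > 0" using t(1) p_pos by simp
  have "energy u \<le> (c + F_integral v) / (t powr p / p)"
  proof (rule fatou(2))
    fix S :: "'v set" assume "finite S"
    from part[OF this] show "sum (energy_term u) S \<le> (c + F_integral v) / (t powr p / p)"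
      unfolding pos_le_divide_eq[OF tp] by (simp only: mult.commute)
  qed
  then have "t powr p / p * energy u \<le> c + F_integral v"
    unfolding pos_le_divide_eq[OF tp] by (simp only: mult.commute)
  then have "J v \<le> c" using t(1) by (simp add: J_eq v_def energy_scale)
  moreover have "c \<le> J u" if "u \<in> \<N>" for u
    unfolding c_def by (rule cINF_lower[OF bdd_below_J that])
  ultimately have "\<forall>u\<in>\<N>. J v \<le> J u" using order_trans by blast
  with v show ?thesis by (intro bexI[of _ v])
qed

section \<open>The Euler-Lagrange equation\<close>

definition bump :: "'v \<Rightarrow> 'v \<Rightarrow> real" where
  "bump x y = (if y = x then 1 else 0)"

lemma grad_inner_eq:
  "grad_inner E w \<sigma> u \<phi> x = 1 / (2 * \<sigma> x) * (\<Sum>y\<in>N x. w x y * (u y - u x) * (\<phi> y - \<phi> x))"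
  unfolding grad_inner_def sum_distrib_left
proof (rule sum.cong[OF refl])
  fix y assume "y \<in> N x"
  then have "sqrt (w x y / (2 * \<sigma> x)) * sqrt (w x y / (2 * \<sigma> x)) = w x y / (2 * \<sigma> x)"
    using w_pos[of y x] sigma_pos[of x] by simp
  then have "grad w \<sigma> u x y * grad w \<sigma> \<phi> x y = w x y / (2 * \<sigma> x) * ((u y - u x) * (\<phi> y - \<phi> x))"
    unfolding grad_def by (simp only: mult_ac)
  then show "grad w \<sigma> u x y * grad w \<sigma> \<phi> x y = 1 / (2 * \<sigma> x) * (w x y * (u y - u x) * (\<phi> y - \<phi> x))"
    by simp
qed

lemma DERIV_gn_powr:
  "((\<lambda>s. gn (\<lambda>y. u y + s * \<phi> y) x powr p / p) has_real_derivative
     gn u x powr (p - 2) * grad_inner E w \<sigma> u \<phi> x) (at 0)"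
proof -
  define Q where "Q s = 1 / (2 * \<sigma> x) * (\<Sum>y\<in>N x. w x y * ((u y + s * \<phi> y) - (u x + s * \<phi> x))\<^sup>2)" for s
  define A where "A = 1 / (2 * \<sigma> x) * (\<Sum>y\<in>N x. w x y * (u y - u x)\<^sup>2)"
  define C where "C = 1 / (2 * \<sigma> x) * (\<Sum>y\<in>N x. w x y * (\<phi> y - \<phi> x)\<^sup>2)"
  have "Q s = A + 2 * grad_inner E w \<sigma> u \<phi> x * s + C * s\<^sup>2" for s
  proof -
    have "w x y * ((u y + s * \<phi> y) - (u x + s * \<phi> x))\<^sup>2 =
        w x y * (u y - u x)\<^sup>2 + 2 * s * (w x y * (u y - u x) * (\<phi> y - \<phi> x)) + s\<^sup>2 * (w x y * (\<phi> y - \<phi> x)\<^sup>2)" for y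
      by (simp add: power2_eq_square algebra_simps)
    then have "(\<Sum>y\<in>N x. w x y * ((u y + s * \<phi> y) - (u x + s * \<phi> x))\<^sup>2) =
        (\<Sum>y\<in>N x. w x y * (u y - u x)\<^sup>2)
        + 2 * s * (\<Sum>y\<in>N x. w x y * (u y - u x) * (\<phi> y - \<phi> x))
        + s\<^sup>2 * (\<Sum>y\<in>N x. w x y * (\<phi> y - \<phi> x)\<^sup>2)"
      by (simp add: sum.distrib sum_distrib_left)
    then show ?thesis
      unfolding Q_def A_def C_def grad_inner_eq by (simp add: distrib_left mult_ac)
  qed
  moreover have "0 \<le> Q s" for s
    unfolding Q_def using sigma_pos[of x] w_pos[of _ x]
    by (intro mult_nonneg_nonneg sum_nonneg) (auto simp: less_imp_le)
  ultimately have "((\<lambda>s. sqrt (Q s) powr p / p) has_real_derivative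
      sqrt A powr (p - 2) * grad_inner E w \<sigma> u \<phi> x) (at 0)"
    by (rule DERIV_sqrt_powr_quadratic[OF p_gt_1])
  then show ?thesis unfolding Q_def A_def grad_norm_def .
qed

lemma bump_finite_energy:
  assumes "finite_energy v" shows "finite_energy (\<lambda>y. v y + s * bump x y)"
proof (rule finite_energy_add(1)[OF assms C_c_finite_energy])
  have "{y. s * bump x y \<noteq> 0} \<subseteq> {x}" by (auto simp: bump_def)
  then show "(\<lambda>y. s * bump x y) \<in> C_c" by (auto simp: C_c_def intro: finite_subset)
qed

text \<open>Green's formula for the indicator of \<open>x\<close>: half of each edge term comes from the gradient at \<open>x\<close>,
  the other half from the gradient at the neighbour.\<close>
lemma sum_bump_grad_inner:
  "(\<Sum>y\<in>insert x (N x). \<sigma> y * (gn v y powr (p - 2) * grad_inner E w \<sigma> v (bump x) y))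
    = - \<sigma> x * p_Laplacian E w \<sigma> p v x"
proof -
  have at_x: "\<sigma> x * (gn v x powr (p - 2) * grad_inner E w \<sigma> v (bump x) x)
      = - (\<Sum>y\<in>N x. gn v x powr (p - 2) / 2 * w x y * (v y - v x))"
  proof -
    have "(\<Sum>y\<in>N x. w x y * (v y - v x) * (bump x y - bump x x)) = - (\<Sum>y\<in>N x. w x y * (v y - v x))"
      unfolding sum_negf[symmetric] using N_irrefl[of x] by (intro sum.cong) (auto simp: bump_def)
    then show ?thesis
      using sigma_pos[of x] by (simp add: grad_inner_eq sum_distrib_left mult_ac)
  qed
  have at_y: "\<sigma> y * (gn v y powr (p - 2) * grad_inner E w \<sigma> v (bump x) y)
      = - (gn v y powr (p - 2) / 2 * w x y * (v y - v x))" if y: "y \<in> N x" for y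
  proof -
    have "(\<Sum>k\<in>N y. w y k * (v k - v y) * (bump x k - bump x y))
        = (\<Sum>k\<in>N y. if k = x then w y x * (v x - v y) else 0)"
      using y N_irrefl[of x] by (intro sum.cong) (auto simp: bump_def)
    also have "\<dots> = w x y * (v x - v y)"
      using y N_sym[of x y] w_sym[OF y] by simp
    finally show ?thesis using sigma_pos[of y] by (simp add: grad_inner_eq right_diff_distrib)
  qed
  have "(\<Sum>y\<in>insert x (N x). \<sigma> y * (gn v y powr (p - 2) * grad_inner E w \<sigma> v (bump x) y))
      = - (\<Sum>y\<in>N x. gn v x powr (p - 2) / 2 * w x y * (v y - v x))
        + (\<Sum>y\<in>N x. - (gn v y powr (p - 2) / 2 * w x y * (v y - v x)))"
    using N_irrefl[of x] at_x at_y by (simp add: sum.insert)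
  also have "\<dots> = - (\<Sum>y\<in>N x. (gn v x powr (p - 2) + gn v y powr (p - 2)) / 2 * w x y * (v y - v x))"
    by (simp add: sum_negf sum.distrib add_divide_distrib distrib_right)
  also have "\<dots> = - \<sigma> x * p_Laplacian E w \<sigma> p v x"
    using sigma_pos[of x] by (simp add: p_Laplacian_def)
  finally show ?thesis .
qed

text \<open>Only the terms at \<open>x\<close> and its neighbours depend on \<open>s\<close>, so the derivative is that of a finite sum.\<close>
lemma DERIV_energy_bump:
  assumes v: "finite_energy v"
  shows "((\<lambda>s. energy (\<lambda>y. v y + s * bump x y) / p) has_real_derivative
    \<sigma> x * (- p_Laplacian E w \<sigma> p v x + \<rho> x * \<bar>v x\<bar> powr (p - 2) * v x)) (at 0)"
proof -
  let ?z = "\<lambda>s y. v y + s * bump x y"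
  let ?S = "insert x (N x)"
  have energy_local: "energy (?z s) / p
      = energy v / p - (\<Sum>y\<in>?S. energy_term v y / p) + (\<Sum>y\<in>?S. energy_term (?z s) y / p)" for s
  proof -
    have "energy (?z s) - energy v = (\<Sum>y\<in>?S. energy_term (?z s) y - energy_term v y)"
      unfolding energy_def
    proof (rule infsum_diff_finite_change)
      fix y assume y: "y \<notin> ?S"
      then have "k \<noteq> x" if "k \<in> N y" for k using that N_sym by auto
      then show "energy_term (?z s) y = energy_term v y"
        using y by (simp add: energy_term_def grad_norm_def bump_def)
    qed (use v bump_finite_energy[OF v] in \<open>auto simp: finite_energy_def\<close>)
    then have "energy (?z s) / p - energy v / p
        = (\<Sum>y\<in>?S. energy_term (?z s) y / p) - (\<Sum>y\<in>?S. energy_term v y / p)"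
      by (simp only: diff_divide_distrib[symmetric] sum_subtractf[symmetric] sum_divide_distrib[symmetric])
    then show ?thesis by linarith
  qed
  let ?D = "\<lambda>y. \<sigma> y * (gn v y powr (p - 2) * grad_inner E w \<sigma> v (bump x) y
      + \<rho> y * (if y = x then \<bar>v x\<bar> powr (p - 2) * v x else 0))"
  have term_deriv: "((\<lambda>s. energy_term (?z s) y / p) has_real_derivative ?D y) (at 0)" for y
  proof -
    have "((\<lambda>s. \<bar>?z s y\<bar> powr p / p) has_real_derivative
        (if y = x then \<bar>v x\<bar> powr (p - 2) * v x else 0)) (at 0)"
      using DERIV_powr_abs[OF p_gt_1, of "v x"] by (cases "y = x") (auto simp: bump_def)
    from DERIV_cmult[OF DERIV_add[OF DERIV_gn_powr DERIV_cmult[OF this]], of "\<sigma> y" v "bump x" y "\<rho> y"]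
    show ?thesis by (simp add: energy_term_def add_divide_distrib distrib_left)
  qed
  have "((\<lambda>s. energy v / p - (\<Sum>y\<in>?S. energy_term v y / p) + (\<Sum>y\<in>?S. energy_term (?z s) y / p))
      has_real_derivative 0 + (\<Sum>y\<in>?S. ?D y)) (at 0)"
    by (intro DERIV_add DERIV_const DERIV_sum term_deriv)
  moreover have "(\<Sum>y\<in>?S. ?D y) = \<sigma> x * (- p_Laplacian E w \<sigma> p v x + \<rho> x * \<bar>v x\<bar> powr (p - 2) * v x)"
  proof -
    have "(\<Sum>y\<in>?S. \<sigma> y * (\<rho> y * (if y = x then \<bar>v x\<bar> powr (p - 2) * v x else 0)))
        = (\<Sum>y\<in>?S. if y = x then \<sigma> x * (\<rho> x * (\<bar>v x\<bar> powr (p - 2) * v x)) else 0)"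
      by (intro sum.cong) auto
    also have "\<dots> = \<sigma> x * (\<rho> x * (\<bar>v x\<bar> powr (p - 2) * v x))" by (subst sum.delta) auto
    finally show ?thesis unfolding distrib_left sum.distrib sum_bump_grad_inner by (simp add: mult_ac)
  qed
  ultimately show ?thesis by (simp only: energy_local add_0)
qed

lemma F_integral_bump:
  assumes v: "finite_energy v" and r: "r > 0"
  shows "F_integral (\<lambda>y. r * (v y + s * bump x y)) - F_integral (\<lambda>y. r * v y)
    = \<sigma> x * (F x (r * (v x + s)) - F x (r * v x))"
proof -
  have "F_integral (\<lambda>y. r * (v y + s * bump x y)) - F_integral (\<lambda>y. r * v y)
    = (\<Sum>y\<in>{x}. F_term (\<lambda>y. r * (v y + s * bump x y)) y - F_term (\<lambda>y. r * v y) y)"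
    unfolding F_integral_def
    using r v bump_finite_energy[OF v]
    by (intro infsum_diff_finite_change summable_F_term finite_energy_scale) (auto simp: F_term_def bump_def)
  then show ?thesis by (simp add: F_term_def bump_def right_diff_distrib)
qed

lemma J_bump_tendsto:
  assumes v: "finite_energy v" and r: "r > 0"
  shows "((\<lambda>s. J (\<lambda>y. r * (v y + s * bump x y))) \<longlongrightarrow> J (\<lambda>y. r * v y)) (at 0)"
proof -
  let ?z = "\<lambda>s y. v y + s * bump x y"
  have e: "((\<lambda>s. energy (?z s) / p) \<longlongrightarrow> energy v / p) (at 0)"
    using DERIV_isCont[OF DERIV_energy_bump[OF v, of x]] by (simp add: isCont_def)
  have F: "((\<lambda>s. F x (r * (v x + s))) \<longlongrightarrow> F x (r * v x)) (at 0)"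
    by (rule isCont_tendsto_compose[OF isCont_F]) (auto intro!: tendsto_eq_intros)
  have J_z: "J (\<lambda>y. r * ?z s y) = r powr p * (energy (?z s) / p)
      - (F_integral (\<lambda>y. r * v y) + \<sigma> x * (F x (r * (v x + s)) - F x (r * v x)))" for s
    using r F_integral_bump[OF v r, of s x] by (simp add: J_eq energy_scale)
  have J_v: "J (\<lambda>y. r * v y) = r powr p * (energy v / p)
      - (F_integral (\<lambda>y. r * v y) + \<sigma> x * (F x (r * v x) - F x (r * v x)))"
    using r by (simp add: J_eq energy_scale)
  show ?thesis unfolding J_z J_v by (intro tendsto_intros e F)
qed

text \<open>For \<open>r \<noteq> 1\<close> the strict maximality of \<open>v\<close> on its ray persists for nearby rays, in the sense
  that \<open>J(r(v + s1\<^sub>x)) < J(v + s1\<^sub>x)\<close> for small \<open>s\<close>.  By unimodality the maximum on the nearby ray is then on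
  the same side of \<open>r\<close> as \<open>1\<close>.\<close>
lemma ray_parameter_tendsto_1:
  assumes v: "v \<in> \<N>"
    and T: "\<forall>\<^sub>F s in at 0. T s > 0 \<and> q (\<lambda>y. v y + s * bump x y) (T s) = energy (\<lambda>y. v y + s * bump x y)"
  shows "(T \<longlongrightarrow> 1) (at 0)"
proof -
  let ?z = "\<lambda>s y. v y + s * bump x y"
  have vfin: "finite_energy v" and q1: "q v 1 = energy v" using v by (auto simp: Nehari_iff q_def)
  note zfin = bump_finite_energy[OF vfin]
  obtain y where y: "v y \<ge> \<delta>" using Nehari_peak[OF v] .
  then have y: "v y > 0" using delta_pos by simp
  have less: "\<forall>\<^sub>F s in at 0. J (\<lambda>y. r * ?z s y) < J (\<lambda>y. 1 * ?z s y)" if r: "r > 0" "r \<noteq> 1" for r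
  proof -
    have "J (\<lambda>y. r * v y) < J (\<lambda>y. 1 * v y)"
      by (rule J_ray_strict_max[OF vfin y zero_less_one q1 r])
    then obtain m where m: "J (\<lambda>y. r * v y) < m" "m < J (\<lambda>y. 1 * v y)" using dense by blast
    have "\<forall>\<^sub>F s in at 0. J (\<lambda>y. r * ?z s y) < m"
      using order_tendstoD(2)[OF J_bump_tendsto[OF vfin r(1)] m(1)] .
    moreover have "\<forall>\<^sub>F s in at 0. m < J (\<lambda>y. 1 * ?z s y)"
      using order_tendstoD(1)[OF J_bump_tendsto[OF vfin zero_less_one] m(2)] .
    ultimately show ?thesis by eventually_elim simp
  qed
  show ?thesis
  proof (rule order_tendstoI)
    fix a :: real assume a: "a < 1"
    define b where "b = max a (1 / 2)"
    have b: "b > 0" "b < 1" "a \<le> b" using a by (auto simp: b_def)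
    have "\<forall>\<^sub>F s in at 0. J (\<lambda>y. b * ?z s y) < J (\<lambda>y. 1 * ?z s y)" using b by (intro less) auto
    then show "\<forall>\<^sub>F s in at 0. a < T s"
      using T
    proof eventually_elim
      case (elim s)
      show ?case
      proof (rule ccontr)
        assume "\<not> a < T s"
        then have Tb: "T s \<le> b" using b by simp
        have "energy (?z s) \<le> q (?z s) b"
          using q_mono[OF zfin _ Tb, of s x] elim by simp
        from J_decreasing_after[OF zfin b(1) _ this, of 1] b elim show False by simp
      qed
    qed
  next
    fix b :: real assume b: "b > 1"
    have "\<forall>\<^sub>F s in at 0. J (\<lambda>y. b * ?z s y) < J (\<lambda>y. 1 * ?z s y)" using b by (intro less) auto
    then show "\<forall>\<^sub>F s in at 0. T s < b"
      using T
    proof eventually_elim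
      case (elim s)
      show ?case
      proof (rule ccontr)
        assume "\<not> T s < b"
        then have Tb: "b \<le> T s" by simp
        have "q (?z s) b \<le> energy (?z s)"
          using q_mono[OF zfin _ Tb, of s x] elim b by simp
        from J_increasing_before[OF zfin zero_less_one _ this] b elim show False by simp
      qed
    qed
  qed
qed

text \<open>With \<open>T s\<close> the parameter at which the ray through \<open>v + s1\<^sub>x\<close> meets the manifold, \<open>J(T s (v + s1\<^sub>x))\<close>
  is at least \<open>J(v)\<close>, hence at least \<open>J(T s v)\<close>.  Homogeneity of the energy and convexity of \<open>F\<close>
  turn this into \<open>key\<close>, an inequality valid for \<open>s\<close> of either sign.  Divided by \<open>s\<close>, it gives the two halves of the equation as
  \<open>s \<rightarrow> 0\<close> from the right and from the left; \<open>T s \<rightarrow> 1\<close> but \<open>T\<close> is not differentiated.\<close>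
lemma minimizer_solves:
  assumes v: "v \<in> \<N>" and min: "\<And>u. u \<in> \<N> \<Longrightarrow> J v \<le> J u"
  shows "- p_Laplacian E w \<sigma> p v x + \<rho> x * \<bar>v x\<bar> powr (p - 2) * v x = f x (v x)"
proof -
  let ?z = "\<lambda>s y. v y + s * bump x y"
  let ?e = "\<lambda>s. energy (?z s) / p"
  define D where "D = \<sigma> x * (- p_Laplacian E w \<sigma> p v x + \<rho> x * \<bar>v x\<bar> powr (p - 2) * v x)"
  have vfin: "finite_energy v" using v by (auto simp: Nehari_iff)
  note zfin = bump_finite_energy[OF vfin]
  obtain y where "v y \<ge> \<delta>" using Nehari_peak[OF v] .
  then have y: "v y > 0" using delta_pos by simp
  have "((\<lambda>s. ?z s y) \<longlongrightarrow> v y + 0 * bump x y) (at 0)" by (intro tendsto_intros)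
  then have pos: "\<forall>\<^sub>F s in at 0. ?z s y > 0" using y by (intro order_tendstoD(1)) auto
  have "\<exists>t. ?z s y > 0 \<longrightarrow> t > 0 \<and> q (?z s) t = energy (?z s)" for s
  proof (cases "?z s y > 0")
    case True
    from Nehari_ray_exists[OF zfin this] obtain t where "t > 0" "q (?z s) t = energy (?z s)" .
    then show ?thesis by blast
  qed simp
  then have "\<forall>s. \<exists>t. ?z s y > 0 \<longrightarrow> t > 0 \<and> q (?z s) t = energy (?z s)" ..
  from choice[OF this]
  obtain T where T': "\<forall>s. ?z s y > 0 \<longrightarrow> T s > 0 \<and> q (?z s) (T s) = energy (?z s)" ..
  have T: "\<forall>\<^sub>F s in at 0. T s > 0 \<and> q (?z s) (T s) = energy (?z s)"
    using pos by eventually_elim (use T' in simp)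
  have T1: "(T \<longlongrightarrow> 1) (at 0)" by (rule ray_parameter_tendsto_1[OF v T])
  have key: "\<forall>\<^sub>F s in at 0. s * (\<sigma> x * T s * f x (T s * v x)) \<le> T s powr p * (?e s - ?e 0)"
    using T pos
  proof eventually_elim
    case (elim s)
    let ?T = "T s"
    have T0: "?T > 0" using elim by simp
    have "(\<lambda>y. ?T * ?z s y) \<in> \<N>" using Nehari_ray_iff[OF zfin T0 elim(2)] elim(1) by simp
    from order_trans[OF J_Nehari_ray_le[OF v T0] min[OF this]]
    have "J (\<lambda>y. ?T * v y) \<le> J (\<lambda>y. ?T * ?z s y)" .
    then have "F_integral (\<lambda>y. ?T * ?z s y) - F_integral (\<lambda>y. ?T * v y) \<le> ?T powr p * (?e s - ?e 0)"
      using T0 by (simp add: J_eq energy_scale right_diff_distrib)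
    moreover have "\<sigma> x * (f x (?T * v x) * (?T * (v x + s) - ?T * v x))
        \<le> \<sigma> x * (F x (?T * (v x + s)) - F x (?T * v x))"
      using F_above_tangent[of x "?T * v x" "?T * (v x + s)"] by (intro mult_left_mono) auto
    ultimately have "\<sigma> x * (f x (?T * v x) * (?T * (v x + s) - ?T * v x)) \<le> ?T powr p * (?e s - ?e 0)"
      unfolding F_integral_bump[OF vfin T0, of s x] by (rule order_trans[rotated])
    moreover have "\<sigma> x * (f x (?T * v x) * (?T * (v x + s) - ?T * v x)) = s * (\<sigma> x * ?T * f x (?T * v x))"
      by (simp add: distrib_left)
    ultimately show ?case by simp
  qed
  have lhs: "((\<lambda>s. \<sigma> x * T s * f x (T s * v x)) \<longlongrightarrow> \<sigma> x * f x (v x)) (at 0)"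
  proof -
    have "((\<lambda>s. f x (T s * v x)) \<longlongrightarrow> f x (1 * v x)) (at 0)"
      by (rule isCont_tendsto_compose[OF isCont_f]) (intro tendsto_intros T1)
    then show ?thesis using T1 by (auto intro!: tendsto_eq_intros)
  qed
  have rhs: "((\<lambda>s. T s powr p * ((?e s - ?e 0) / s)) \<longlongrightarrow> D) (at 0)"
  proof -
    have "((\<lambda>s. (?e s - ?e 0) / s) \<longlongrightarrow> D) (at 0)"
      using DERIV_energy_bump[OF vfin, of x] by (simp add: DERIV_def D_def)
    moreover have "((\<lambda>s. T s powr p) \<longlongrightarrow> 1 powr p) (at 0)" by (intro tendsto_powr T1 tendsto_const) auto
    ultimately show ?thesis using tendsto_mult by fastforce
  qed
  have "\<sigma> x * f x (v x) \<le> D"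
  proof (rule tendsto_le[OF trivial_limit_at_right_real])
    show "((\<lambda>s. \<sigma> x * T s * f x (T s * v x)) \<longlongrightarrow> \<sigma> x * f x (v x)) (at_right 0)"
      using lhs by (simp add: filterlim_at_split)
    show "((\<lambda>s. T s powr p * ((?e s - ?e 0) / s)) \<longlongrightarrow> D) (at_right 0)"
      using rhs by (simp add: filterlim_at_split)
    have "\<forall>\<^sub>F s in at_right (0::real). s > 0" by (rule eventually_at_right_less)
    moreover have "\<forall>\<^sub>F s in at_right 0. s * (\<sigma> x * T s * f x (T s * v x)) \<le> T s powr p * (?e s - ?e 0)"
      using key by (simp add: eventually_at_split)
    ultimately show "\<forall>\<^sub>F s in at_right 0. \<sigma> x * T s * f x (T s * v x) \<le> T s powr p * ((?e s - ?e 0) / s)"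
      by eventually_elim (simp add: pos_le_divide_eq mult.commute)
  qed
  moreover have "D \<le> \<sigma> x * f x (v x)"
  proof (rule tendsto_le[OF trivial_limit_at_left_real])
    show "((\<lambda>s. \<sigma> x * T s * f x (T s * v x)) \<longlongrightarrow> \<sigma> x * f x (v x)) (at_left 0)"
      using lhs by (simp add: filterlim_at_split)
    show "((\<lambda>s. T s powr p * ((?e s - ?e 0) / s)) \<longlongrightarrow> D) (at_left 0)"
      using rhs by (simp add: filterlim_at_split)
    have "\<forall>\<^sub>F s in at_left (0::real). s < 0" by (auto simp: eventually_at_filter)
    moreover have "\<forall>\<^sub>F s in at_left 0. s * (\<sigma> x * T s * f x (T s * v x)) \<le> T s powr p * (?e s - ?e 0)"
      using key by (simp add: eventually_at_split)
    ultimately show "\<forall>\<^sub>F s in at_left 0. T s powr p * ((?e s - ?e 0) / s) \<le> \<sigma> x * T s * f x (T s * v x)"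
      by eventually_elim (simp add: neg_divide_le_eq mult.commute)
  qed
  ultimately have "\<sigma> x * (- p_Laplacian E w \<sigma> p v x + \<rho> x * \<bar>v x\<bar> powr (p - 2) * v x) = \<sigma> x * f x (v x)"
    unfolding D_def by (rule antisym[rotated])
  then show ?thesis using sigma_pos[of x] by simp
qed

section \<open>Positivity\<close>

text \<open>At a minimum \<open>\<Delta>\<^sub>p v(x)\<close> is a sum of nonnegative terms, and \<open>v(x) \<le> 0\<close> makes the equation
  bound it above by \<open>0\<close>.\<close>
lemma nonpos_min_spreads:
  assumes eq: "- p_Laplacian E w \<sigma> p v x + \<rho> x * \<bar>v x\<bar> powr (p - 2) * v x = f x (v x)"
    and "v x \<le> 0" "\<And>y. v x \<le> v y" "y \<in> N x"
  shows "v y = v x"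
proof (rule ccontr)
  assume ne: "v y \<noteq> v x"
  let ?t = "\<lambda>y. (gn v x powr (p - 2) + gn v y powr (p - 2)) / 2 * w x y * (v y - v x)"
  have nn: "0 \<le> ?t k" if "k \<in> N x" for k
    using w_pos[OF that] assms(3)[of k] by (intro mult_nonneg_nonneg) auto
  have "gn v x \<noteq> 0" using gn_eq_0[of v x y] ne assms(4) by blast
  then have "gn v x powr (p - 2) > 0" by simp
  then have "0 < ?t y"
    using w_pos[OF assms(4)] assms(3)[of y] ne by (intro mult_pos_pos) (auto simp: add_pos_nonneg)
  also have "\<dots> \<le> sum ?t (N x)" using assms(4) nn by (intro member_le_sum) auto
  finally have "p_Laplacian E w \<sigma> p v x > 0" using sigma_pos[of x] by (simp add: p_Laplacian_def)
  moreover have "\<rho> x * \<bar>v x\<bar> powr (p - 2) * v x \<le> 0"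
    using rho_nonneg[of x] assms(2) by (intro mult_nonneg_nonpos) auto
  moreover have "f x (v x) = 0" using assms(2) by simp
  ultimately show False using eq by linarith
qed

lemma solution_pos:
  assumes v: "finite_energy v" and peak: "v x\<^sub>0 > 0"
    and eq: "\<And>x. - p_Laplacian E w \<sigma> p v x + \<rho> x * \<bar>v x\<bar> powr (p - 2) * v x = f x (v x)"
  shows "v x > 0"
proof (rule ccontr)
  assume neg: "\<not> v x > 0"
  obtain m where m: "v m \<le> 0" "\<And>y. v m \<le> v y"
  proof (cases "\<exists>z. v z < 0")
    case True
    then obtain z where z: "v z < 0" by blast
    \<comment> \<open>a negative infimum is attained, as \<open>v\<close> tends to \<open>0\<close> at infinity\<close>
    have "{y. v y \<le> v z} \<subseteq> {y. \<bar>v y\<bar> \<ge> - v z}" by auto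
    then have fin: "finite {y. v y \<le> v z}"
      using finite_superlevel[OF v, of "- v z"] z finite_subset by auto
    define m where "m = arg_min_on v {y. v y \<le> v z}"
    have m: "v m \<le> v z" "v m \<le> v y" if "v y \<le> v z" for y
      using arg_min_if_finite[OF fin, of v] arg_min_least[OF fin _ , of y v] that
      unfolding m_def by auto
    have "v m \<le> 0" using m(1)[of z] z by simp
    moreover have "v m \<le> v y" for y using m[of y] m(1)[of z] by (cases "v y \<le> v z") auto
    ultimately show thesis by (rule that)
  next
    case False
    then have "v x \<le> v y" for y using neg by (meson not_less order_trans)
    with neg show thesis by (intro that[of x]) auto
  qed
  have "v y = v m" if "(m, y) \<in> (adj_rel E)\<^sup>*" for y
    using that
  proof induction
    case (step y z)
    then have "z \<in> N y" by (simp add: adj_rel_def)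
    have "v z = v y" by (rule nonpos_min_spreads[OF eq _ _ \<open>z \<in> N y\<close>]) (use m step.IH in simp_all)
    then show ?case using step.IH by simp
  qed simp
  then have "v x\<^sub>0 = v m" using connected by (simp add: connected_graph_def)
  with m peak show False by simp
qed

theorem positive_ground_state:
  "\<exists>u. ground_state_solution E w \<sigma> p \<rho> \<psi> u \<and> (\<forall>x. u x > 0)"
proof -
  from Nehari_minimizer_exists obtain v where v: "v \<in> \<N>" and "\<forall>u\<in>\<N>. J v \<le> J u" ..
  then have min: "\<And>u. u \<in> \<N> \<Longrightarrow> J v \<le> J u" by simp
  note eq = minimizer_solves[OF v min]
  obtain y where "v y \<ge> \<delta>" using Nehari_peak[OF v] .
  then have y: "v y > 0" using delta_pos by simp
  have "finite_energy v" using v by (simp add: Nehari_iff)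
  from solution_pos[OF this y eq] have "v x > 0" for x .
  moreover have "J v = (INF u\<in>\<N>. J u)"
    using v min by (intro cInf_eq_minimum[symmetric]) auto
  moreover have "solves_equation E w \<sigma> p \<rho> \<psi> v"
    using eq by (simp add: solves_equation_def f_def pos_part_def)
  ultimately show ?thesis
    unfolding ground_state_solution_def by (intro exI[of _ v] conjI v bdd_below_J allI)
qed

end

section \<open>Balls in the graph\<close>

lemma finite_relpow_preimage:
  fixes R :: "('a \<times> 'a) set"
  assumes "\<And>y. finite {x. (x, y) \<in> R}"
  shows "finite {x. (x, y) \<in> R ^^ n}"
proof (induction n arbitrary: y)
  case (Suc n)
  have "{x. (x, y) \<in> R ^^ Suc n} = (\<Union>z\<in>{z. (z, y) \<in> R}. {x. (x, z) \<in> R ^^ n})" by auto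
  then show ?case using Suc assms by simp
qed simp

lemma finite_graph_ball:
  assumes "connected_graph E" "locally_finite_graph E"
  shows "finite {x. graph_dist E x x\<^sub>0 < n}"
proof -
  have "{x. (x, y) \<in> adj_rel E} = nbrs E y" for y
    by (auto simp: adj_rel_def nbrs_def insert_commute)
  then have fin: "finite {x. (x, x\<^sub>0) \<in> adj_rel E ^^ k}" for k
    using assms(2) by (intro finite_relpow_preimage) (simp add: locally_finite_graph_def)
  have "(x, x\<^sub>0) \<in> adj_rel E ^^ graph_dist E x x\<^sub>0" for x
  proof -
    have "\<exists>k. (x, x\<^sub>0) \<in> adj_rel E ^^ k"
      using assms(1) by (auto simp: connected_graph_def rtrancl_power)
    then show ?thesis unfolding graph_dist_def by (rule LeastI_ex)
  qed
  then have "{x. graph_dist E x x\<^sub>0 < n} \<subseteq> (\<Union>k<n. {x. (x, x\<^sub>0) \<in> adj_rel E ^^ k})" by auto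
  then show ?thesis using fin by (auto intro: finite_subset)
qed

theorem theorem1p2:
  fixes E :: "'v set set"
    and w :: "'v \<Rightarrow> 'v \<Rightarrow> real"
    and \<sigma> \<rho> :: "'v \<Rightarrow> real"
    and \<sigma>\<^sub>0 p \<alpha> :: real
    and x\<^sub>0 :: 'v
    and \<psi> :: "'v \<Rightarrow> real \<Rightarrow> real"
  assumes graph: "simple_graph E" "connected_graph E" "locally_finite_graph E"
    and weight: "edge_weight E w"
    and measure: "\<sigma>\<^sub>0 > 0" "\<And>x. \<sigma> x \<ge> \<sigma>\<^sub>0"
    and p: "p > 1"
    and rho_nonneg: "\<And>x. \<rho> x \<ge> 0"
    and rho_lim: "filterlim \<rho> at_top (filtercomap (\<lambda>x. graph_dist E x x\<^sub>0) at_top)"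
    and i_zero: "\<And>x. \<psi> x 0 = 0"
    and i_cont: "\<And>x. continuous_on {0..} (\<psi> x)"
    and i_bound: "\<And>M. M > 0 \<Longrightarrow> \<exists>A. \<forall>x. \<forall>s\<in>{0..M}. \<psi> x s \<le> A"
    and ii: "\<alpha> > p"
      "\<And>x s. s > 0 \<Longrightarrow> 0 < \<alpha> * primitive \<psi> x s \<and> \<alpha> * primitive \<psi> x s \<le> s * \<psi> x s"
    and iii: "\<exists>\<tau> \<delta>. \<tau> < lambda_p E w \<sigma> p \<rho> \<and> \<delta> > 0
      \<and> (\<forall>x s. 0 < s \<and> s < \<delta> \<longrightarrow> \<psi> x s \<le> \<tau> * s powr (p - 1))"
    and iv: "\<And>x. strict_mono_on {0<..} (\<lambda>s. \<psi> x s / s powr (p - 1))"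
  shows "\<exists>u. ground_state_solution E w \<sigma> p \<rho> \<psi> u \<and> (\<forall>x. u x > 0)"
proof -
  have sublevel: "finite {x. \<rho> x < R}" for R
  proof -
    have "\<forall>\<^sub>F x in filtercomap (\<lambda>x. graph_dist E x x\<^sub>0) at_top. R \<le> \<rho> x"
      using rho_lim by (simp add: filterlim_at_top)
    then obtain n where "\<And>x. n \<le> graph_dist E x x\<^sub>0 \<Longrightarrow> R \<le> \<rho> x"
      unfolding eventually_filtercomap eventually_at_top_linorder by blast
    then have "{x. \<rho> x < R} \<subseteq> {x. graph_dist E x x\<^sub>0 < n}" by (force simp: not_less[symmetric])
    then show ?thesis using finite_graph_ball[OF graph(2,3)] finite_subset by blast
  qed
  obtain \<tau> \<delta> where td: "\<tau> < lambda_p E w \<sigma> p \<rho>" "\<delta> > 0"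
      "\<And>x s. 0 < s \<Longrightarrow> s < \<delta> \<Longrightarrow> \<psi> x s \<le> \<tau> * s powr (p - 1)"
    using iii by blast
  interpret superlinear_problem E w \<sigma> \<rho> \<sigma>\<^sub>0 p \<psi> \<alpha> \<tau> \<delta>
    by unfold_locales (fact graph weight measure p rho_nonneg sublevel i_zero i_cont ii td iv)+
  show ?thesis by (rule positive_ground_state)
qed

end
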